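(* Let $k\ge 1$ be an integer. Then for every unitary operator $U$ on $\mathbb{C}^{3k-1}$ with $3k-1$ distinct eigenvalues, $\Lambda_k(U)=\Omega_k(U)$.
   Context: Let $T$ be an operator on $\mathbb{C}^N$ with eigenvalues $\lambda_1,\dots,\lambda_N$ (listed with multiplicity), and let $1\le k\le N$. $\Lambda_k(T)$ is the $k$th (higher-rank) numerical range: the set of $\lambda\in\mathbb{C}$ such that $PTP=\lambda P$ for some orthogonal projection $P$ of rank $k$. $\Omega_k(T)=\bigcap_{S}\operatorname{conv}\{\lambda_j: j\in S\}$, where $S$ runs over all subsets of $\{1,\dots,N\}$ with exactly $N-k+1$ elements. *)

theory Defs
  imports
    "HOL-Analysis.Convex"
    "HOL-Combinatorics.Permutations"
    "Jordan_Normal_Form.Spectral_Radius"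
    "Jordan_Normal_Form.Schur_Decomposition"
    "Jordan_Normal_Form.DL_Rank"
begin

text \<open>
  An operator on \<open>\<complex>\<^sup>N\<close> is represented by its \<open>N \<times> N\<close> matrix with respect to the standard
  orthonormal basis, so that \<open>mat_adjoint\<close> (the conjugate transpose) is the adjoint operator.
\<close>

definition unitary_mat :: "complex mat \<Rightarrow> bool" where
  "unitary_mat U \<longleftrightarrow> square_mat U \<and>
     mat_adjoint U * U = 1\<^sub>m (dim_row U) \<and> U * mat_adjoint U = 1\<^sub>m (dim_row U)"

definition orthogonal_projection :: "complex mat \<Rightarrow> bool" where
  "orthogonal_projection P \<longleftrightarrow> square_mat P \<and> P * P = P \<and> mat_adjoint P = P"

definition higher_rank_numerical_range :: "nat \<Rightarrow> complex mat \<Rightarrow> complex set" where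
  "higher_rank_numerical_range k T =
     {\<mu>. \<exists>P \<in> carrier_mat (dim_row T) (dim_row T).
        orthogonal_projection P \<and> vec_space.rank (dim_row T) P = k \<and> P * T * P = \<mu> \<cdot>\<^sub>m P}"

text \<open>
  A listing \<open>\<lambda>\<^sub>0, \<dots>, \<lambda>\<^bsub>N-1\<^esub>\<close> of the eigenvalues, repeated according to algebraic multiplicity.
  The order is chosen arbitrarily; \<open>Omega_eq_listing\<close> shows that \<open>Omega\<close> does not depend on it.
\<close>

definition eigenvalue_list :: "complex mat \<Rightarrow> complex list" where
  "eigenvalue_list T = (SOME es. char_poly T = (\<Prod>e\<leftarrow>es. [:- e, 1:]))"

text \<open>The index set is \<open>{0, \<dots>, N-1}\<close> rather than \<open>{1, \<dots>, N}\<close>; only \<open>1 \<le> k \<le> N\<close> is meaningful.\<close>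

definition Omega :: "nat \<Rightarrow> complex mat \<Rightarrow> complex set" where
  "Omega k T =
     (\<Inter>S \<in> {S. S \<subseteq> {..<dim_row T} \<and> card S = dim_row T - k + 1}.
        convex hull ((\<lambda>j. eigenvalue_list T ! j) ` S))"

lemma char_poly_eigenvalue_list:
  assumes "T \<in> carrier_mat n n"
  shows "char_poly T = (\<Prod>e\<leftarrow>eigenvalue_list T. [:- e, 1:])"
  unfolding eigenvalue_list_def
  by (rule someI_ex) (use char_poly_factorized[OF assms] in blast)

lemma proots_prod_list_linear:
  "proots (\<Prod>e\<leftarrow>es. [:- e, 1:]) = mset (es :: complex list)"
proof (induction es)
  case (Cons e es)
  have "(\<Prod>e\<leftarrow>es. [:- e, 1:]) \<noteq> (0 :: complex poly)"
    by (auto simp: prod_list_zero_iff)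
  then show ?case
    using Cons by (simp add: proots_mult del: mult_pCons_left)
qed simp

lemma mset_eigenvalue_list:
  assumes "T \<in> carrier_mat n n" "char_poly T = (\<Prod>e\<leftarrow>es. [:- e, 1:])"
  shows "mset (eigenvalue_list T) = mset es"
  using char_poly_eigenvalue_list[OF assms(1)] assms(2) proots_prod_list_linear by metis

lemma length_eigenvalue_list:
  assumes "T \<in> carrier_mat n n"
  shows "length (eigenvalue_list T) = n"
  using char_poly_factorized[OF assms] mset_eigenvalue_list[OF assms] mset_eq_length by metis

lemma Omega_eq_listing:
  assumes T: "T \<in> carrier_mat n n" and es: "char_poly T = (\<Prod>e\<leftarrow>es. [:- e, 1:])"
  shows "Omega k T =
    (\<Inter>S \<in> {S. S \<subseteq> {..<n} \<and> card S = n - k + 1}. convex hull ((\<lambda>j. es ! j) ` S))"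
proof -
  let ?F = "\<lambda>xs :: complex list.
    (\<lambda>S. (\<lambda>j. xs ! j) ` S) ` {S. S \<subseteq> {..<n} \<and> card S = n - k + 1}"
  have sub: "?F xs \<subseteq> ?F ys" if mset: "mset xs = mset ys" and len: "length ys = n" for xs ys
  proof -
    obtain p where p: "p permutes {..<length ys}" "permute_list p ys = xs"
      using mset_eq_permutation[OF mset] .
    have nth: "xs ! j = ys ! p j" if "j < n" for j
      using permute_list_nth[OF p(1), of j] p(2) that len by simp
    show ?thesis
    proof
      fix A assume "A \<in> ?F xs"
      then obtain S where S: "S \<subseteq> {..<n}" "card S = n - k + 1" "A = (\<lambda>j. xs ! j) ` S"
        by blast
      have "A = (\<lambda>j. ys ! j) ` (p ` S)"
        unfolding S(3) image_image using S(1) nth by (intro image_cong) auto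
      moreover have "p ` S \<subseteq> {..<n}"
        using image_mono[OF S(1), of p] permutes_image[OF p(1)] len by simp
      moreover have "card (p ` S) = n - k + 1"
        using S(2) card_image[OF permutes_inj_on[OF p(1)], of S] by simp
      ultimately show "A \<in> ?F ys" by blast
    qed
  qed
  have m: "mset (eigenvalue_list T) = mset es" and l: "length (eigenvalue_list T) = n"
    using mset_eigenvalue_list[OF T es] length_eigenvalue_list[OF T] by auto
  then have "?F (eigenvalue_list T) = ?F es"
    using sub[OF m] sub[OF m[symmetric]] mset_eq_length[OF m] by (intro subset_antisym) simp_all
  then have "(\<Inter>A \<in> ?F (eigenvalue_list T). convex hull A) = (\<Inter>A \<in> ?F es. convex hull A)"
    by simp
  then show ?thesis
    using T by (simp add: Omega_def image_image)
qed

end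

theory Submission
  imports Defs "HOL-Analysis.Convex_Euclidean_Space"
begin

hide_const (open) Finite_Cartesian_Product.vec Finite_Cartesian_Product.mat
hide_type (open) Finite_Cartesian_Product.vec
no_notation Finite_Cartesian_Product.vec_nth (infixl \<open>$\<close> 90)

text \<open>
  \<open>\<Lambda>\<^sub>k \<subseteq> \<Omega>\<^sub>k\<close>: a \<open>k\<close>-dimensional space meets the span of any \<open>N - k + 1\<close> eigenvectors, and a unit
  vector in the intersection exhibits \<open>\<mu>\<close> as a convex combination of their eigenvalues.

  \<open>\<Omega>\<^sub>k \<subseteq> \<Lambda>\<^sub>k\<close>: put \<open>z\<^sub>l = \<lambda>\<^sub>l - \<mu>\<close>. If \<open>\<mu> \<in> \<Omega>\<^sub>k\<close>, then every closed half-plane bounded by a line through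
  \<open>0\<close> contains at least \<open>k\<close> of the \<open>z\<^sub>l\<close>, and it suffices to find \<open>k\<close> orthonormal vectors that are totally
  isotropic for the form \<open>diag z\<close>. For \<open>k \<ge> 3\<close> one can split off three points whose hull contains \<open>0\<close>
  (one isotropic vector) such that the remaining \<open>3(k - 1) - 1\<close> points have half-plane depth \<open>k - 1\<close>.
  This leaves five points of depth \<open>2\<close>. Either an opposite pair can be split off, or, with \<open>[x, y]\<close>
  denoting the determinant, all products \<open>\<Prod>\<^bsub>m \<noteq> l\<^esub> [z\<^sub>m, z\<^sub>l]\<close> are positive; then the vectors
  \<open>f(z\<^sub>l) (\<Prod>\<^bsub>m \<noteq> l\<^esub> [z\<^sub>m, z\<^sub>l])\<^sup>-\<^sup>1\<^sup>/\<^sup>2\<close> with \<open>f\<close> a real linear form span an isotropic plane, because the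
  Lagrange sum \<open>\<Sum>\<^sub>l q(z\<^sub>l) / \<Prod>\<^bsub>m \<noteq> l\<^esub> [z\<^sub>m, z\<^sub>l]\<close> vanishes for every cubic form \<open>q\<close>.
\<close>

section \<open>Half-plane depth and isotropic families\<close>

text \<open>\<open>Re (cnj w * z l)\<close> is the real inner product of \<open>w\<close> and
  \<open>z l\<close>, so this bounds the Tukey depth of the origin from below. Indices are counted
  rather than points, so coinciding points count separately.\<close>

definition depth :: "('i \<Rightarrow> complex) \<Rightarrow> 'i set \<Rightarrow> nat \<Rightarrow> bool" where
  "depth z Z k \<longleftrightarrow> (\<forall>w. w \<noteq> 0 \<longrightarrow> k \<le> card {l \<in> Z. 0 \<le> Re (cnj w * z l)})"

text \<open>The coefficient vectors are real, so the bilinear and the sesquilinear reading of the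
  second sum agree; all constructions below produce real vectors.\<close>

definition isotropic :: "('i \<Rightarrow> complex) \<Rightarrow> 'i set \<Rightarrow> nat \<Rightarrow> bool" where
  "isotropic z Z k \<longleftrightarrow> (\<exists>v :: nat \<Rightarrow> 'i \<Rightarrow> real. \<forall>a<k. \<forall>b<k.
     (\<Sum>l\<in>Z. v a l * v b l) = of_bool (a = b) \<and>
     (\<Sum>l\<in>Z. (v a l * v b l) *\<^sub>R z l) = 0)"

text \<open>Both families are extended by zero; disjoint supports make every mixed sum
  vanish.\<close>

lemma isotropic_Un:
  assumes "finite A" "finite B" "A \<inter> B = {}" "isotropic z A m" "isotropic z B n"
  shows "isotropic z (A \<union> B) (m + n)"
proof -
  obtain v where v: "\<And>a b. a < m \<Longrightarrow> b < m \<Longrightarrow> (\<Sum>l\<in>A. v a l * v b l) = of_bool (a = b)"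
      "\<And>a b. a < m \<Longrightarrow> b < m \<Longrightarrow> (\<Sum>l\<in>A. (v a l * v b l) *\<^sub>R z l) = 0"
    using assms(4) unfolding isotropic_def by blast
  obtain w where w: "\<And>a b. a < n \<Longrightarrow> b < n \<Longrightarrow> (\<Sum>l\<in>B. w a l * w b l) = of_bool (a = b)"
      "\<And>a b. a < n \<Longrightarrow> b < n \<Longrightarrow> (\<Sum>l\<in>B. (w a l * w b l) *\<^sub>R z l) = 0"
    using assms(5) unfolding isotropic_def by blast
  define x where "x a l = (if a < m then v a l * of_bool (l \<in> A) else w (a - m) l * of_bool (l \<in> B))"
    for a l
  \<comment> \<open>The parameter \<open>f\<close> covers the inner product and the form with one
    computation.\<close>
  have A: "(\<Sum>l\<in>A. f (x a l * x b l) l) = (if a < m \<and> b < m then \<Sum>l\<in>A. f (v a l * v b l) l else 0)"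
    if "\<And>l. f 0 l = 0" for f :: "real \<Rightarrow> _ \<Rightarrow> 'b::comm_monoid_add" and a b
    using that assms(3) by (auto simp: x_def intro!: sum.cong sum.neutral)
  have B: "(\<Sum>l\<in>B. f (x a l * x b l) l) =
      (if \<not> a < m \<and> \<not> b < m then \<Sum>l\<in>B. f (w (a - m) l * w (b - m) l) l else 0)"
    if "\<And>l. f 0 l = 0" for f :: "real \<Rightarrow> _ \<Rightarrow> 'b::comm_monoid_add" and a b
    using that assms(3) by (auto simp: x_def intro!: sum.cong sum.neutral)
  show ?thesis
    unfolding isotropic_def
  proof (intro exI[of _ x] allI impI conjI)
    fix a b assume ab: "a < m + n" "b < m + n"
    show "(\<Sum>l\<in>A \<union> B. x a l * x b l) = of_bool (a = b)"
      using A[of "\<lambda>r l. r" a b] B[of "\<lambda>r l. r" a b] assms(1-3) ab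
      by (auto simp: sum.union_disjoint v(1) w(1))
    show "(\<Sum>l\<in>A \<union> B. (x a l * x b l) *\<^sub>R z l) = 0"
      using A[of "\<lambda>r l. r *\<^sub>R z l" a b] B[of "\<lambda>r l. r *\<^sub>R z l" a b] assms(1-3) ab
      by (auto simp: sum.union_disjoint v(2) w(2))
  qed
qed

lemma isotropic_reindex:
  assumes "bij_betw h A Z" "isotropic (\<lambda>j. z (h j)) A k"
  shows "isotropic z Z k"
proof -
  obtain v where v: "\<And>a b. a < k \<Longrightarrow> b < k \<Longrightarrow> (\<Sum>j\<in>A. v a j * v b j) = of_bool (a = b)"
      "\<And>a b. a < k \<Longrightarrow> b < k \<Longrightarrow> (\<Sum>j\<in>A. (v a j * v b j) *\<^sub>R z (h j)) = 0"
    using assms(2) unfolding isotropic_def by blast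
  have inv: "inv_into A h (h j) = j" if "j \<in> A" for j
    using assms(1) that by (simp add: bij_betw_inv_into_left)
  show ?thesis
    unfolding isotropic_def
    by (intro exI[of _ "\<lambda>a l. v a (inv_into A h l)"])
      (simp add: sum.reindex_bij_betw[OF assms(1), symmetric] inv v)
qed

text \<open>The square roots of the coefficients in a convex combination equal to 0 form an
  isotropic unit vector.\<close>

lemma isotropic_1_of_hull:
  assumes "finite Z" "0 \<in> convex hull (z ` Z)"
  shows "isotropic z Z 1"
proof -
  \<comment> \<open>One index is kept for each value of \<open>z\<close>, so that hull coefficients
    attached to points can be moved to indices; the other indices get weight 0.\<close>
  obtain A where A: "A \<subseteq> Z" "inj_on z A" "z ` Z = z ` A"
    using subset_image_inj[of "z ` Z" z Z] by auto
  obtain u where u: "\<And>y. y \<in> z ` A \<Longrightarrow> 0 \<le> u y" "sum u (z ` A) = 1"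
      "(\<Sum>y\<in>z ` A. u y *\<^sub>R y) = 0"
  proof -
    have "0 \<in> convex hull (z ` A)" "finite (z ` A)"
      using assms A(3) by (metis, metis finite_imageI)
    then show ?thesis
      using that unfolding convex_hull_finite[OF \<open>finite (z ` A)\<close>] by blast
  qed
  define w where "w l = (if l \<in> A then u (z l) else 0)" for l
  have sum_w: "(\<Sum>l\<in>Z. f (w l) l) = (\<Sum>l\<in>A. f (u (z l)) l)" if "\<And>l. f 0 l = 0"
    for f :: "real \<Rightarrow> _ \<Rightarrow> 'b::comm_monoid_add"
    using assms(1) A(1) that by (intro sum.mono_neutral_cong_right) (auto simp: w_def)
  have "0 \<le> w l" for l
    using u(1) by (simp add: w_def)
  moreover have "sum w Z = 1" "(\<Sum>l\<in>Z. w l *\<^sub>R z l) = 0"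
    using sum_w[of "\<lambda>r l. r"] sum_w[of "\<lambda>r l. r *\<^sub>R z l"] u(2,3) A(2)
    by (simp_all add: sum.reindex)
  ultimately show ?thesis
    unfolding isotropic_def by (intro exI[of _ "\<lambda>a l. sqrt (w l)"]) simp
qed

text \<open>A line strictly separating 0 from the hull leaves the closed half-plane with normal
  \<open>- a\<close> empty.\<close>

lemma depth_1_imp_hull:
  assumes "finite Z" "depth z Z 1"
  shows "0 \<in> convex hull (z ` Z)"
proof (rule ccontr)
  assume "0 \<notin> convex hull (z ` Z)"
  then obtain a b where ab: "a \<noteq> 0" "0 < b" "\<And>x. x \<in> convex hull (z ` Z) \<Longrightarrow> b < inner a x"
    using separating_hyperplane_closed_0[of "convex hull (z ` Z)"] assms(1)
    by (metis compact_imp_closed convex_convex_hull finite_imageI finite_imp_compact_convex_hull)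
  have "{l \<in> Z. 0 \<le> Re (cnj (- a) * z l)} = {}"
    using ab(2) ab(3)[OF hull_inc] by (force simp: inner_complex_def)
  then show False
    using assms(2) ab(1) unfolding depth_def by (metis card.empty neg_equal_0_iff_equal not_one_le_zero)
qed

lemma isotropic_1_of_depth:
  "finite Z \<Longrightarrow> depth z Z 1 \<Longrightarrow> isotropic z Z 1"
  using isotropic_1_of_hull depth_1_imp_hull by blast

text \<open>Gram-Schmidt stays inside the isotropic span of \<open>u\<close> and \<open>v\<close>.
  The entries at \<open>l\<close> and \<open>m\<close> certify linear independence: \<open>u\<close>
  is nonzero, and no multiple of \<open>u\<close> agrees with \<open>v\<close> at
  \<open>l\<close>.\<close>

lemma isotropic_2I:
  fixes u v :: "'i \<Rightarrow> real"
  assumes "finite Z" and l: "l \<in> Z" "u l = 0" "v l \<noteq> 0" and m: "m \<in> Z" "u m \<noteq> 0"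
    and z: "(\<Sum>l\<in>Z. (u l * u l) *\<^sub>R z l) = 0" "(\<Sum>l\<in>Z. (u l * v l) *\<^sub>R z l) = 0"
      "(\<Sum>l\<in>Z. (v l * v l) *\<^sub>R z l) = 0"
  shows "isotropic z Z 2"
proof -
  define \<alpha> where "\<alpha> = (\<Sum>l\<in>Z. u l * u l)"
  define c where "c = (\<Sum>l\<in>Z. u l * v l) / \<alpha>"
  define x where "x l = v l - c * u l" for l
  define \<beta> where "\<beta> = (\<Sum>l\<in>Z. x l * x l)"
  have \<alpha>: "\<alpha> > 0" unfolding \<alpha>_def
    using m assms(1) by (intro sum_pos2[where i = m]) (auto simp: zero_less_mult_iff)
  have \<beta>: "\<beta> > 0" unfolding \<beta>_def
    using l assms(1) by (intro sum_pos2[where i = l]) (auto simp: x_def zero_less_mult_iff)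
  have ux: "(\<Sum>l\<in>Z. u l * x l) = 0"
    using \<alpha> by (simp add: x_def algebra_simps sum_subtractf flip: sum_distrib_left)
      (simp add: c_def \<alpha>_def)
  have zx: "(\<Sum>l\<in>Z. (u l * x l) *\<^sub>R z l) = 0"
  proof -
    have "(\<Sum>l\<in>Z. (u l * x l) *\<^sub>R z l) = (\<Sum>l\<in>Z. (u l * v l) *\<^sub>R z l - c *\<^sub>R ((u l * u l) *\<^sub>R z l))"
      by (intro sum.cong) (auto simp: x_def algebra_simps)
    then show ?thesis by (simp add: sum_subtractf z scaleR_sum_right[symmetric] del: scaleR_scaleR)
  qed
  have zxx: "(\<Sum>l\<in>Z. (x l * x l) *\<^sub>R z l) = 0"
  proof -
    have "(\<Sum>l\<in>Z. (x l * x l) *\<^sub>R z l) = (\<Sum>l\<in>Z. (v l * v l) *\<^sub>R z l - (2 * c) *\<^sub>R ((u l * v l) *\<^sub>R z l)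
        + (c * c) *\<^sub>R ((u l * u l) *\<^sub>R z l))"
      by (intro sum.cong) (auto simp: x_def algebra_simps)
    then show ?thesis by (simp add: sum_subtractf sum.distrib z scaleR_sum_right[symmetric] del: scaleR_scaleR)
  qed
  define y where "y a l = (if a = (0::nat) then u l / sqrt \<alpha> else x l / sqrt \<beta>)" for a l
  have 1: "(\<Sum>l\<in>Z. y 0 l * y 0 l) = 1" "(\<Sum>l\<in>Z. y 1 l * y 1 l) = 1"
    "(\<Sum>l\<in>Z. y 0 l * y 1 l) = 0"
    using \<alpha> \<beta> ux by (simp_all add: y_def flip: sum_divide_distrib) (simp_all add: \<alpha>_def \<beta>_def)
  have e: "(\<Sum>l\<in>Z. (p l * q l / d) *\<^sub>R z l) = (1 / d) *\<^sub>R (\<Sum>l\<in>Z. (p l * q l) *\<^sub>R z l)"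
    for p q :: "'i \<Rightarrow> real" and d
    by (simp add: scaleR_sum_right)
  have 2: "(\<Sum>l\<in>Z. (y 0 l * y 0 l) *\<^sub>R z l) = 0" "(\<Sum>l\<in>Z. (y 1 l * y 1 l) *\<^sub>R z l) = 0"
    "(\<Sum>l\<in>Z. (y 0 l * y 1 l) *\<^sub>R z l) = 0"
    by (simp_all add: y_def e z zx zxx)
  have sw: "(\<Sum>l\<in>Z. f (y 1 l * y 0 l) l) = (\<Sum>l\<in>Z. f (y 0 l * y 1 l) l)"
     for f :: "real \<Rightarrow> 'i \<Rightarrow> 'b::comm_monoid_add"
    by (simp add: mult.commute)
  show ?thesis
    unfolding isotropic_def
    using 1 2 sw[of "\<lambda>r l. r"] sw[of "\<lambda>r l. r *\<^sub>R z l"]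
    by (intro exI[of _ y]) (simp add: numeral_2_eq_2 All_less_Suc)
qed

section \<open>Five points in star position\<close>

definition cross :: "complex \<Rightarrow> complex \<Rightarrow> real" where
  "cross x y = Re x * Im y - Im x * Re y"

text \<open>Cramer's rule: the determinants with \<open>p\<close> and \<open>q\<close> determine
  both coordinates of \<open>x\<close>.\<close>

lemma cross_zeroI:
  assumes "cross p x = 0" "cross q x = 0" "cross p q \<noteq> 0"
  shows "x = 0"
proof -
  have "cross p q * Re x = cross p x * Re q - cross q x * Re p"
    "cross p q * Im x = cross p x * Im q - cross q x * Im p"
    by (simp_all add: cross_def algebra_simps)
  then show ?thesis using assms by (simp add: complex_eq_iff)
qed

lemma cross_sum: "cross p (\<Sum>l\<in>A. c l *\<^sub>R f l) = (\<Sum>l\<in>A. c l * cross p (f l))"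
  by (simp add: cross_def sum_distrib_left sum_subtractf[symmetric] algebra_simps)

lemma cross_commute: "cross x y = - cross y x"
  by (simp add: cross_def)

lemma cross_self [simp]: "cross x x = 0"
  by (simp add: cross_def)

lemma pluecker: "cross a b * cross c d - cross a c * cross b d + cross a d * cross b c = 0"
  by (simp add: cross_def algebra_simps)

text \<open>The signs are those of five directions in counterclockwise order for which two steps
  turn by less than a half-turn and three steps by more. They make all five Lagrange weights
  positive, so that square roots can be taken.\<close>

lemma isotropic_pentagon:
  fixes y :: "int \<Rightarrow> complex"
  defines "b \<equiv> \<lambda>i j. cross (y i) (y j)"
  assumes pos: "0 < b 0 1" "0 < b 0 2" "0 < b 1 2" "0 < b 1 3" "0 < b 2 3" "0 < b 2 4" "0 < b 3 4"
    and neg: "b 0 3 < 0" "b 0 4 < 0" "b 1 4 < 0"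
  shows "isotropic y {0..<5} 2"
proof -
  have set: "{0..<5} = {0, 1, 2, 3, 4::int}" by auto
  \<comment> \<open>Lagrange weights; the isotropic vectors are \<open>sqrt (w l) * [y i, y l]\<close> for \<open>i = 0, 1\<close>\<close>
  define w where "w l = (1 / (\<Prod>m\<in>{0..<5} - {l}. b m l))" for l
  have bc: "b i j = - b j i" for i j by (simp add: b_def cross_commute[of "y i"])
  have bs [simp]: "b i i = 0" for i by (simp add: b_def)
  have pl: "b i j * b k l - b i k * b j l + b i l * b j k = 0" for i j k l
    by (simp add: b_def pluecker)
  have wv: "w 0 = 1 / (b 0 1 * b 0 2 * b 0 3 * b 0 4)" "w 1 = - 1 / (b 0 1 * b 1 2 * b 1 3 * b 1 4)"
    "w 2 = 1 / (b 0 2 * b 1 2 * b 2 3 * b 2 4)" "w 3 = - 1 / (b 0 3 * b 1 3 * b 2 3 * b 3 4)"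
    "w 4 = 1 / (b 0 4 * b 1 4 * b 2 4 * b 3 4)"
    unfolding w_def set using bc[of 1 0] bc[of 2 0] bc[of 3 0] bc[of 4 0] bc[of 2 1] bc[of 3 1]
      bc[of 4 1] bc[of 3 2] bc[of 4 2] bc[of 4 3]
    by (simp_all add: insert_Diff_if mult.assoc)
  note nz = pos[THEN less_imp_neq, symmetric] neg[THEN less_imp_neq]
  have p4: "0 < p * q * r * s" if "0 < p" "0 < q" "0 < r" "0 < s" for p q r s :: real
    using that by simp
  have "0 < b 0 1 * b 0 2 * (- b 0 3) * (- b 0 4)"
    by (rule p4) (use pos neg in simp_all)
  then have wp0: "0 < w 0" by (simp add: wv)
  have "0 < b 0 1 * b 1 2 * b 1 3 * (- b 1 4)"
    by (rule p4) (use pos neg in simp_all)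
  then have wp1: "0 < w 1" by (simp add: wv)
  have "0 < b 0 2 * b 1 2 * b 2 3 * b 2 4"
    by (rule p4) (use pos neg in simp_all)
  then have wp2: "0 < w 2" by (simp add: wv)
  have "0 < (- b 0 3) * b 1 3 * b 2 3 * b 3 4"
    by (rule p4) (use pos neg in simp_all)
  then have wp3: "0 < w 3" by (simp add: wv)
  have "0 < (- b 0 4) * (- b 1 4) * b 2 4 * b 3 4"
    by (rule p4) (use pos neg in simp_all)
  then have wp4: "0 < w 4" by (simp add: wv)
  have w: "0 \<le> w l" if "l \<in> {0..<5}" for l
    using that wp0 wp1 wp2 wp3 wp4 unfolding set by auto
  \<comment> \<open>Each vector sum is tested against two independent points through
    \<open>cross\<close>; the factor \<open>b i l\<close> then cancels summands and denominators.
    The exponents (2,0), (1,1), (0,2) give the three pairings of the two vectors.\<close>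
  have cr: "cross (y i) (\<Sum>l\<in>{0..<5}. (w l * (b 0 l) ^ p * (b 1 l) ^ q) *\<^sub>R y l) =
      w 0 * b 0 0 ^ p * b 1 0 ^ q * b i 0 + w 1 * b 0 1 ^ p * b 1 1 ^ q * b i 1
      + w 2 * b 0 2 ^ p * b 1 2 ^ q * b i 2
      + w 3 * b 0 3 ^ p * b 1 3 ^ q * b i 3 + w 4 * b 0 4 ^ p * b 1 4 ^ q * b i 4" for i p q
    unfolding cross_sum unfolding set by (simp add: b_def)
  have b10: "b 1 0 = - b 0 1" "b 2 0 = - b 0 2" "b 3 0 = - b 0 3" "b 4 0 = - b 0 4" "b 2 1 = - b 1 2"
    "b 3 1 = - b 1 3" "b 4 1 = - b 1 4" "b 3 2 = - b 2 3" "b 4 2 = - b 2 4" "b 4 3 = - b 3 4"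
    by (rule bc)+
  \<comment> \<open>Over the common denominator \<open>p * q * r\<close> such a sum has a Pluecker
    relation as numerator.\<close>
  have tri: "x / (p * q) + - y / (p * r) + z / (q * r) = 0"
    if "x * r - y * q + z * p = 0" "p \<noteq> 0" "q \<noteq> 0" "r \<noteq> 0" for x y z p q r :: real
  proof -
    have "x / (p * q) + - y / (p * r) + z / (q * r) = (x * r - y * q + z * p) / (p * q * r)"
      using that(2-4) by (simp add: field_simps)
    then show ?thesis using that(1) by simp
  qed
  \<comment> \<open>The factor \<open>b 0 l\<close> removes index 0 and the test point removes its
    own index; the remaining three summands form a \<open>tri\<close> sum.\<close>
  have S20: "(\<Sum>l\<in>{0..<5}. (w l * (b 0 l) ^ 2 * (b 1 l) ^ 0) *\<^sub>R y l) = 0"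
  proof (rule cross_zeroI[of "y 1" _ "y 2"])
    have e: "w 2 * b 0 2 ^ 2 * b 1 2 ^ 0 * b 1 2 = b 0 2 / (b 2 3 * b 2 4)"
      "w 3 * b 0 3 ^ 2 * b 1 3 ^ 0 * b 1 3 = - b 0 3 / (b 2 3 * b 3 4)"
      "w 4 * b 0 4 ^ 2 * b 1 4 ^ 0 * b 1 4 = b 0 4 / (b 2 4 * b 3 4)"
      using nz by (simp_all add: wv b10 power2_eq_square)
    have "cross (y 1) (\<Sum>l\<in>{0..<5}. (w l * (b 0 l) ^ 2 * (b 1 l) ^ 0) *\<^sub>R y l) =
        b 0 2 / (b 2 3 * b 2 4) + - b 0 3 / (b 2 3 * b 3 4) + b 0 4 / (b 2 4 * b 3 4)"
      unfolding cr e by simp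
    also have "\<dots> = 0"
      using pl[of 0 2 3 4] nz by (intro tri) simp_all
    finally show "cross (y 1) (\<Sum>l\<in>{0..<5}. (w l * (b 0 l) ^ 2 * (b 1 l) ^ 0) *\<^sub>R y l) = 0" .
    have e: "w 1 * b 0 1 ^ 2 * b 1 1 ^ 0 * b 2 1 = b 0 1 / (b 1 3 * b 1 4)"
      "w 3 * b 0 3 ^ 2 * b 1 3 ^ 0 * b 2 3 = - b 0 3 / (b 1 3 * b 3 4)"
      "w 4 * b 0 4 ^ 2 * b 1 4 ^ 0 * b 2 4 = b 0 4 / (b 1 4 * b 3 4)"
      using nz by (simp_all add: wv b10 power2_eq_square)
    have "cross (y 2) (\<Sum>l\<in>{0..<5}. (w l * (b 0 l) ^ 2 * (b 1 l) ^ 0) *\<^sub>R y l) =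
        b 0 1 / (b 1 3 * b 1 4) + - b 0 3 / (b 1 3 * b 3 4) + b 0 4 / (b 1 4 * b 3 4)"
      unfolding cr e by simp
    also have "\<dots> = 0"
      using pl[of 0 1 3 4] nz by (intro tri) simp_all
    finally show "cross (y 2) (\<Sum>l\<in>{0..<5}. (w l * (b 0 l) ^ 2 * (b 1 l) ^ 0) *\<^sub>R y l) = 0" .
  qed (use nz in \<open>auto simp: b_def\<close>)
  \<comment> \<open>Indices 0 and 1 vanish by the factors, the test point removes a third, and the
    last two summands are opposite.\<close>
  have S11: "(\<Sum>l\<in>{0..<5}. (w l * (b 0 l) ^ 1 * (b 1 l) ^ 1) *\<^sub>R y l) = 0"
  proof (rule cross_zeroI[of "y 2" _ "y 3"])
    have e: "w 3 * b 0 3 ^ 1 * b 1 3 ^ 1 * b 2 3 = - 1 / b 3 4"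
      "w 4 * b 0 4 ^ 1 * b 1 4 ^ 1 * b 2 4 = 1 / b 3 4"
      using nz by (simp_all add: wv b10 power2_eq_square)
    have "cross (y 2) (\<Sum>l\<in>{0..<5}. (w l * (b 0 l) ^ 1 * (b 1 l) ^ 1) *\<^sub>R y l) =
        - 1 / b 3 4 + 1 / b 3 4"
      unfolding cr e by simp
    then show "cross (y 2) (\<Sum>l\<in>{0..<5}. (w l * (b 0 l) ^ 1 * (b 1 l) ^ 1) *\<^sub>R y l) = 0" by simp
    have e: "w 2 * b 0 2 ^ 1 * b 1 2 ^ 1 * b 3 2 = - 1 / b 2 4"
      "w 4 * b 0 4 ^ 1 * b 1 4 ^ 1 * b 3 4 = 1 / b 2 4"
      using nz by (simp_all add: wv b10 power2_eq_square)
    have "cross (y 3) (\<Sum>l\<in>{0..<5}. (w l * (b 0 l) ^ 1 * (b 1 l) ^ 1) *\<^sub>R y l) =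
        - 1 / b 2 4 + 1 / b 2 4"
      unfolding cr e by simp
    then show "cross (y 3) (\<Sum>l\<in>{0..<5}. (w l * (b 0 l) ^ 1 * (b 1 l) ^ 1) *\<^sub>R y l) = 0" by simp
  qed (use nz in \<open>auto simp: b_def\<close>)
  have S02: "(\<Sum>l\<in>{0..<5}. (w l * (b 0 l) ^ 0 * (b 1 l) ^ 2) *\<^sub>R y l) = 0"
  proof (rule cross_zeroI[of "y 0" _ "y 2"])
    have e: "w 2 * b 0 2 ^ 0 * b 1 2 ^ 2 * b 0 2 = b 1 2 / (b 2 3 * b 2 4)"
      "w 3 * b 0 3 ^ 0 * b 1 3 ^ 2 * b 0 3 = - b 1 3 / (b 2 3 * b 3 4)"
      "w 4 * b 0 4 ^ 0 * b 1 4 ^ 2 * b 0 4 = b 1 4 / (b 2 4 * b 3 4)"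
      using nz by (simp_all add: wv b10 power2_eq_square)
    have "cross (y 0) (\<Sum>l\<in>{0..<5}. (w l * (b 0 l) ^ 0 * (b 1 l) ^ 2) *\<^sub>R y l) =
        b 1 2 / (b 2 3 * b 2 4) + - b 1 3 / (b 2 3 * b 3 4) + b 1 4 / (b 2 4 * b 3 4)"
      unfolding cr e by simp
    also have "\<dots> = 0"
      using pl[of 1 2 3 4] nz by (intro tri) simp_all
    finally show "cross (y 0) (\<Sum>l\<in>{0..<5}. (w l * (b 0 l) ^ 0 * (b 1 l) ^ 2) *\<^sub>R y l) = 0" .
    have e: "w 0 * b 0 0 ^ 0 * b 1 0 ^ 2 * b 2 0 = - b 0 1 / (b 0 3 * b 0 4)"
      "w 3 * b 0 3 ^ 0 * b 1 3 ^ 2 * b 2 3 = - b 1 3 / (b 0 3 * b 3 4)"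
      "w 4 * b 0 4 ^ 0 * b 1 4 ^ 2 * b 2 4 = b 1 4 / (b 0 4 * b 3 4)"
      using nz by (simp_all add: wv b10 power2_eq_square)
    have "cross (y 2) (\<Sum>l\<in>{0..<5}. (w l * (b 0 l) ^ 0 * (b 1 l) ^ 2) *\<^sub>R y l) =
        - b 0 1 / (b 0 3 * b 0 4) + - b 1 3 / (b 0 3 * b 3 4) + b 1 4 / (b 0 4 * b 3 4)"
      unfolding cr e by simp
    also have "\<dots> = 0"
    proof (intro tri)
        show "- b 0 1 * b 3 4 - b 1 3 * b 0 4 + b 1 4 * b 0 3 = 0"
          using pl[of 0 1 3 4] mult.commute[of "b 1 3" "b 0 4"] mult.commute[of "b 1 4" "b 0 3"]
          by linarith
      qed (use nz in simp_all)
    finally show "cross (y 2) (\<Sum>l\<in>{0..<5}. (w l * (b 0 l) ^ 0 * (b 1 l) ^ 2) *\<^sub>R y l) = 0" .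
  qed (use nz in \<open>auto simp: b_def\<close>)
  define u where "u i l = sqrt (w l) * b i l" for i l
  have uu: "(\<Sum>l\<in>{0..<5}. (u i l * u j l) *\<^sub>R y l) = (\<Sum>l\<in>{0..<5}. (w l * (b i l * b j l)) *\<^sub>R y l)"
    for i j
  proof (intro sum.cong refl)
    fix l :: int assume "l \<in> {0..<5}"
    have "u i l * u j l = (sqrt (w l) * sqrt (w l)) * (b i l * b j l)"
      by (simp only: u_def mult_ac)
    then show "(u i l * u j l) *\<^sub>R y l = (w l * (b i l * b j l)) *\<^sub>R y l"
      using w[OF \<open>l \<in> _\<close>] by simp
  qed
  \<comment> \<open>Index 0 separates the two vectors: \<open>u 0\<close> vanishes there and
    \<open>u 1\<close> does not.\<close>
  have "u 1 0 \<noteq> 0" "u 0 1 \<noteq> 0"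
    using nz wp0 wp1 b10 by (simp_all add: u_def)
  moreover have "u 0 0 = 0" by (simp add: u_def)
  moreover have "(\<Sum>l\<in>{0..<5}. (u 0 l * u 0 l) *\<^sub>R y l) = 0"
    "(\<Sum>l\<in>{0..<5}. (u 0 l * u 1 l) *\<^sub>R y l) = 0" "(\<Sum>l\<in>{0..<5}. (u 1 l * u 1 l) *\<^sub>R y l) = 0"
    unfolding uu using S20 S11 S02 by (simp_all only: power2_eq_square power_one_right power_0 mult_1_right mult.assoc)
  ultimately show ?thesis
    by (intro isotropic_2I[of _ 0 "u 0" "u 1" 1]) simp_all
qed

section \<open>Points in cyclic order\<close>

lemma int_step_exists:
  fixes P :: "int \<Rightarrow> bool"
  assumes "\<not> P i" "P j" "i \<le> j"
  obtains a where "\<not> P (a - 1)" "P a"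
proof -
  define n where "n = (LEAST n. P (i + int n))"
  have ex: "P (i + int (nat (j - i)))" using assms by simp
  have Pn: "P (i + int n)" unfolding n_def by (rule LeastI[of _ "nat (j - i)"], rule ex)
  have "n \<noteq> 0" using Pn assms(1) by (cases n) auto
  then have "\<not> P (i + int (n - 1))"
    unfolding n_def by (intro not_less_Least) simp
  moreover have "i + int (n - 1) = i + int n - 1" using \<open>n \<noteq> 0\<close> by simp
  ultimately show thesis using that Pn by metis
qed

lemma cis_plus_2pi_int: "cis (x + 2 * pi * of_int n) = cis x"
  by (simp flip: cis_mult)

lemma sin_nonneg_lift:
  assumes "0 \<le> sin x"
  obtains n :: int where "0 \<le> x + 2 * pi * n" "x + 2 * pi * n \<le> pi"
proof -
  define n where "n = - \<lfloor>x / (2 * pi)\<rfloor>"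
  define y where "y = x + 2 * pi * n"
  have "y = 2 * pi * frac (x / (2 * pi))"
    by (simp add: y_def n_def frac_def field_simps)
  then have y: "0 \<le> y" "y < 2 * pi"
    using frac_ge_0[of "x / (2 * pi)"] frac_lt_1[of "x / (2 * pi)"] by simp_all
  have "sin y = sin x"
    using cis_plus_2pi_int[of x n] unfolding y_def by (metis cis.sel(2))
  then have "y \<le> pi" using y assms sin_lt_zero[of y] by (cases "y \<le> pi") auto
  then show thesis using that y unfolding y_def by blast
qed

text \<open>
  \<open>\<theta>\<close> lifts the arguments of the points, listed counterclockwise by \<open>g\<close>, to all of \<open>\<int>\<close>, so that
  half-planes become intervals of indices and no reduction modulo \<open>N\<close> is needed.
\<close>

locale cyclic_order =
  fixes z :: "'i \<Rightarrow> complex" and Z :: "'i set" and N :: nat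
    and g :: "int \<Rightarrow> 'i" and \<theta> :: "int \<Rightarrow> real"
  assumes N_pos: "0 < N"
    and mono_\<theta>: "mono \<theta>"
    and \<theta>_period: "\<theta> (j + int N) = \<theta> j + 2 * pi"
    and g_period: "g (j + int N) = g j"
    and bij_g: "bij_betw g {0..<int N} Z"
    and nonzero: "l \<in> Z \<Longrightarrow> z l \<noteq> 0"
    and polar: "sgn (z (g j)) = cis (\<theta> j)"
begin

section \<open>Periodicity of the listing, and half-planes as runs of indices\<close>

lemma \<theta>_periods: "\<theta> (j + int N * n) = \<theta> j + 2 * pi * n"
proof (induction n rule: int_induct[of _ 0])
  case (step1 i)
  then show ?case using \<theta>_period[of "j + int N * i"] by (simp add: algebra_simps)
next
  case (step2 i)
  then show ?case using \<theta>_period[of "j + int N * (i - 1)"] by (simp add: algebra_simps)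
qed simp

lemma g_periods: "g (j + int N * n) = g j"
proof (induction n rule: int_induct[of _ 0])
  case (step1 i)
  then show ?case using g_period[of "j + int N * i"] by (simp add: algebra_simps)
next
  case (step2 i)
  then show ?case using g_period[of "j + int N * (i - 1)"] by (simp add: algebra_simps)
qed simp

lemma g_mod: "g (j mod int N) = g j"
  using g_periods[of "j mod int N" "j div int N"] by simp

lemma g_in: "g j \<in> Z"
  using bij_betw_apply[OF bij_g, of "j mod int N"] N_pos g_mod[of j] by simp

lemma g_eq_iff: "g i = g j \<longleftrightarrow> i mod int N = j mod int N"
proof -
  have "i mod int N \<in> {0..<int N}" "j mod int N \<in> {0..<int N}" using N_pos by auto
  then show ?thesis
    using bij_betw_imp_inj_on[OF bij_g, THEN inj_onD, of "i mod int N" "j mod int N"] g_mod by metis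
qed

lemma inj_g: "inj_on g {a..<a + int N}"
proof (rule inj_onI)
  fix i j assume ij: "i \<in> {a..<a + int N}" "j \<in> {a..<a + int N}" "g i = g j"
  then have "int N dvd i - j" by (simp add: g_eq_iff mod_eq_dvd_iff)
  moreover have "\<bar>i - j\<bar> < int N" using ij by auto
  ultimately show "i = j" using zdvd_not_zless[of "\<bar>i - j\<bar>" "int N"] by force
qed

lemma image_g: "g ` {a..<a + int N} = Z"
proof (rule subset_antisym)
  have "finite Z" "card Z = N"
    using bij_g bij_betw_finite[OF bij_g] bij_betw_same_card[OF bij_g] by auto
  then show "Z \<subseteq> g ` {a..<a + int N}"
    using card_image[OF inj_g[of a]] card_subset_eq[of Z "g ` {a..<a + int N}"] g_in by auto
qed (use g_in in auto)

lemma finite_Z: "finite Z"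
  using bij_betw_finite[OF bij_g] by simp

text \<open>The normal \<open>cis (\<phi> + pi / 2)\<close> belongs to the half-plane of directions
  from \<open>\<phi>\<close> to \<open>\<phi> + pi\<close>, which are those with nonnegative sine
  relative to \<open>\<phi>\<close>.\<close>

lemma in_halfplane:
  "0 \<le> Re (cnj (cis (\<phi> + pi / 2)) * z (g j)) \<longleftrightarrow> 0 \<le> sin (\<theta> j - \<phi>)"
proof -
  have "z (g j) = cmod (z (g j)) * cis (\<theta> j)"
    using polar[of j] nonzero[OF g_in[of j]] by (simp add: sgn_eq field_simps)
  then have "Re (z (g j)) = cmod (z (g j)) * cos (\<theta> j)" "Im (z (g j)) = cmod (z (g j)) * sin (\<theta> j)"
    by (metis Re_rcis rcis_def, metis Im_rcis rcis_def)
  then have "Re (cnj (cis (\<phi> + pi / 2)) * z (g j)) =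
      cmod (z (g j)) * (cos (\<phi> + pi / 2) * cos (\<theta> j) + sin (\<phi> + pi / 2) * sin (\<theta> j))"
    by (simp add: algebra_simps)
  also have "\<dots> = cmod (z (g j)) * sin (\<theta> j - \<phi>)"
    by (simp add: sin_diff cos_add sin_add algebra_simps)
  finally show ?thesis using nonzero[OF g_in[of j]] by (simp add: zero_le_mult_iff)
qed

lemma halfplane_lift:
  assumes "0 \<le> Re (cnj (cis (\<phi> + pi / 2)) * z l)" "l \<in> Z"
  obtains j where "g j = l" "\<phi> \<le> \<theta> j" "\<theta> j \<le> \<phi> + pi"
proof -
  obtain i where i: "l = g i" using assms(2) image_g[of 0] by auto
  obtain n :: int where "0 \<le> \<theta> i - \<phi> + 2 * pi * n" "\<theta> i - \<phi> + 2 * pi * n \<le> pi"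
    using sin_nonneg_lift assms(1) unfolding i in_halfplane by metis
  then show thesis using that[of "i + int N * n"] by (simp add: i \<theta>_periods g_periods)
qed

lemma \<theta>_le: "i \<le> j \<Longrightarrow> \<theta> i \<le> \<theta> j"
  using mono_\<theta> by (simp add: monoD)

lemma \<theta>_less_imp: "\<theta> i < \<theta> j \<Longrightarrow> i < j"
  using \<theta>_le by (meson not_le)

text \<open>If \<open>k\<close> steps from \<open>j\<close> turned by more than a half-turn, a
  half-plane would fit strictly between the two ends and contain at most the \<open>k - 1\<close>
  indices in between.\<close>

lemma depth_gap:
  assumes "depth z Z k"
  shows "\<theta> (j + int k) \<le> \<theta> j + pi"
proof (rule ccontr)
  assume *: "\<not> ?thesis"
  \<comment> \<open>This centres the interval from \<open>\<phi>\<close> to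
    \<open>\<phi> + pi\<close> inside the gap, leaving room on both sides.\<close>
  define \<phi> where "\<phi> = (\<theta> j + \<theta> (j + int k) - pi) / 2"
  have \<phi>: "\<theta> j < \<phi>" "\<phi> + pi < \<theta> (j + int k)"
    using * by (auto simp: \<phi>_def field_simps)
  have "{l \<in> Z. 0 \<le> Re (cnj (cis (\<phi> + pi / 2)) * z l)} \<subseteq> g ` {j+1..<j + int k}"
  proof clarify
    fix l assume l: "l \<in> Z" "0 \<le> Re (cnj (cis (\<phi> + pi / 2)) * z l)"
    then obtain i where "g i = l" "\<phi> \<le> \<theta> i" "\<theta> i \<le> \<phi> + pi" using halfplane_lift by metis
    moreover from this have "j < i" "i < j + int k" using \<phi> \<theta>_less_imp by fastforce+
    ultimately show "l \<in> g ` {j+1..<j + int k}" by auto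
  qed
  then have "card {l \<in> Z. 0 \<le> Re (cnj (cis (\<phi> + pi / 2)) * z l)} \<le> card {j+1..<j + int k}"
    using surj_card_le[of "{j+1..<j + int k}"] by blast
  moreover have "k \<le> card {l \<in> Z. 0 \<le> Re (cnj (cis (\<phi> + pi / 2)) * z l)}"
    using assms cis_neq_zero unfolding depth_def by blast
  \<comment> \<open>The case \<open>k = 0\<close> must be excluded, as the index interval is then
    empty and the two bounds do not clash.\<close>
  moreover have "k \<noteq> 0" using * by (intro notI) simp
  ultimately show False by simp
qed

text \<open>The lifted arguments of a half-plane fill a closed interval of length \<open>pi\<close>,
  hence a run of indices. The inequality between \<open>a - 1\<close> and \<open>c\<close> later
  bounds its length from below, and \<open>b\<close> lets the caller choose the period containing
  \<open>a\<close>.\<close>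

lemma halfplane_run:
  assumes "w \<noteq> 0"
  obtains a c where "b \<le> a" "a < b + int N" "a \<le> c" "c \<le> a + int N" "\<theta> (a - 1) + pi < \<theta> c"
    "{l \<in> Z. 0 \<le> Re (cnj w * z l)} = g ` {a..<c}"
proof -
  define \<phi>0 where "\<phi>0 = Arg w - pi / 2"
  have far: "\<exists>n::int. x < y + 2 * pi * n" for x y
  proof -
    obtain n :: int where "(x - y) / (2 * pi) < n" using ex_less_of_int by blast
    then show ?thesis by (intro exI[of _ n]) (simp add: field_simps)
  qed
  obtain n1 :: int where n1: "\<phi>0 < \<theta> 0 + 2 * pi * n1" using far by blast
  obtain n2 :: int where n2: "- \<phi>0 < - \<theta> 0 + 2 * pi * n2" using far by blast
  have "\<theta> (0 + int N * (- n2)) < \<phi>0" "\<phi>0 \<le> \<theta> (0 + int N * n1)"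
    using n1 n2 unfolding \<theta>_periods by auto
  moreover from this have "0 + int N * (- n2) \<le> 0 + int N * n1" using \<theta>_less_imp by (meson less_le_trans less_imp_le)
  ultimately obtain a0 where a0: "\<theta> (a0 - 1) < \<phi>0" "\<phi>0 \<le> \<theta> a0"
    using int_step_exists[of "\<lambda>j. \<phi>0 \<le> \<theta> j"] by (metis not_le)
  \<comment> \<open>Shifting by this many full periods moves \<open>a0\<close> into the period that
    starts at \<open>b\<close>.\<close>
  define m where "m = - ((a0 - b) div int N)"
  define a where "a = a0 + int N * m"
  define \<phi> where "\<phi> = \<phi>0 + 2 * pi * m"
  have "a = b + (a0 - b) mod int N"
    unfolding a_def m_def by (simp add: minus_mult_div_eq_mod[symmetric] algebra_simps)
  then have ab: "b \<le> a" "a < b + int N" using N_pos by auto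
  have a: "\<theta> (a - 1) < \<phi>" "\<phi> \<le> \<theta> a"
    using a0 \<theta>_periods[of "a0 - 1" m] \<theta>_periods[of a0 m] by (simp_all add: a_def \<phi>_def algebra_simps)
  \<comment> \<open>These two ends start the search for \<open>c\<close>, the index just past the
    last one with angle at most \<open>\<phi> + pi\<close>.\<close>
  have "\<not> \<phi> + pi < \<theta> (a - 1)" "\<phi> + pi < \<theta> (a + int N)"
    using a pi_gt_zero \<theta>_period[of a] by linarith+
  then obtain c where c: "\<not> \<phi> + pi < \<theta> (c - 1)" "\<phi> + pi < \<theta> c"
    using int_step_exists[of "\<lambda>j. \<phi> + pi < \<theta> j" "a - 1" "a + int N"] by auto
  have "a - 1 < c" using a c pi_gt_zero by (intro \<theta>_less_imp) linarith
  moreover have "c - 1 < a + int N"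
    using \<open>\<phi> + pi < \<theta> (a + int N)\<close> c by (intro \<theta>_less_imp) linarith
  moreover have "{l \<in> Z. 0 \<le> Re (cnj w * z l)} = g ` {a..<c}"
  proof -
    have w: "w = cmod w * cis (\<phi> + pi / 2)"
    proof -
      have "cis (\<phi> + pi / 2) = cis (Arg w + 2 * pi * m)"
        by (simp add: \<phi>_def \<phi>0_def)
      also have "\<dots> = cis (Arg w)"
        by (rule cis_plus_2pi_int)
      finally show ?thesis using rcis_cmod_Arg[of w] by (simp add: rcis_def)
    qed
    have "0 \<le> Re (cnj w * z l) \<longleftrightarrow> 0 \<le> Re (cnj (cis (\<phi> + pi / 2)) * z l)" for l
    proof -
      have "Re (cnj w * z l) = cmod w * Re (cnj (cis (\<phi> + pi / 2)) * z l)"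
        by (subst w) (simp add: algebra_simps)
      then show ?thesis using assms by (simp add: zero_le_mult_iff)
    qed
    then have "{l \<in> Z. 0 \<le> Re (cnj w * z l)} = {l \<in> Z. 0 \<le> Re (cnj (cis (\<phi> + pi / 2)) * z l)}"
      by simp
    also have "\<dots> = g ` {a..<c}"
    proof (intro subset_antisym subsetI)
      fix l assume l: "l \<in> {l \<in> Z. 0 \<le> Re (cnj (cis (\<phi> + pi / 2)) * z l)}"
      then obtain j where j: "g j = l" "\<phi> \<le> \<theta> j" "\<theta> j \<le> \<phi> + pi" using halfplane_lift by blast
      then have "a - 1 < j" "j < c" using a c by (auto intro!: \<theta>_less_imp)
      then show "l \<in> g ` {a..<c}" using j by auto
    next
      fix l assume "l \<in> g ` {a..<c}"
      then obtain j where j: "l = g j" "a \<le> j" "j \<le> c - 1" by auto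
      then have "\<phi> \<le> \<theta> j" "\<theta> j \<le> \<phi> + pi" using \<theta>_le a c by (smt (verit))+
      then have "0 \<le> sin (\<theta> j - \<phi>)" by (intro sin_ge_zero) auto
      then show "l \<in> {l \<in> Z. 0 \<le> Re (cnj (cis (\<phi> + pi / 2)) * z l)}"
        using in_halfplane g_in j by auto
    qed
    finally show ?thesis .
  qed
  ultimately show thesis using that[of a c] ab a c by auto
qed

text \<open>By \<open>gap\<close>, the run cut out by a half-plane contains at least its first
  \<open>k\<close> indices, so it is enough that \<open>T\<close> meets every window of length
  \<open>k\<close> that starts within one period.\<close>

lemma depth_1I:
  assumes "T \<subseteq> Z" "\<And>a. b \<le> a \<Longrightarrow> a < b + int N \<Longrightarrow> g ` {a..<a + int k} \<inter> T \<noteq> {}"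
    and gap: "\<And>j. \<theta> (j + int k) \<le> \<theta> j + pi"
  shows "depth z T 1"
  unfolding depth_def
proof (intro allI impI)
  fix w :: complex assume "w \<noteq> 0"
  then obtain a c where ac: "b \<le> a" "a < b + int N" "a \<le> c" "c \<le> a + int N" "\<theta> (a - 1) + pi < \<theta> c"
      "{l \<in> Z. 0 \<le> Re (cnj w * z l)} = g ` {a..<c}"
    by (rule halfplane_run)
  have "a - 1 + int k < c"
    using gap[of "a - 1"] ac(5) by (intro \<theta>_less_imp) simp
  then have "g ` {a..<a + int k} \<subseteq> {l \<in> Z. 0 \<le> Re (cnj w * z l)}"
    unfolding ac(6) by (intro image_mono) auto
  then have "{l \<in> T. 0 \<le> Re (cnj w * z l)} \<noteq> {}"
    using assms(2)[OF ac(1,2)] by blast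
  moreover have "finite {l \<in> T. 0 \<le> Re (cnj w * z l)}"
    using finite_subset[OF assms(1) finite_Z] by simp
  ultimately show "1 \<le> card {l \<in> T. 0 \<le> Re (cnj w * z l)}"
    by (simp add: Suc_le_eq card_gt_0_iff)
qed

text \<open>
  A half-plane is a run of at least \<open>k\<close> indices. By \<open>one\<close> its first \<open>k\<close> indices lose at most one point,
  except for a run that starts at \<open>i + 1\<close>; by \<open>good\<close> such a run has at least \<open>k + 1\<close> elements, so that
  losing two of them is harmless.
\<close>

lemma depth_diffI:
  assumes gap: "\<And>j. \<theta> (j + int k) \<le> \<theta> j + pi"
    and good: "\<theta> (i + int k + 1) \<le> \<theta> i + pi"
    and one: "\<And>a. i + 2 \<le> a \<Longrightarrow> a \<le> i + int N \<Longrightarrow>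
      \<exists>t. {x \<in> {a..<a + int k}. g x \<in> T} \<subseteq> {t}"
    and two: "\<exists>s t. {x \<in> {i + 1..i + 1 + int k}. g x \<in> T} \<subseteq> {s, t}"
  shows "depth z (Z - T) (k - 1)"
  unfolding depth_def
proof (intro allI impI)
  fix w :: complex assume "w \<noteq> 0"
  then obtain a c where ac: "i + 1 \<le> a" "a < i + 1 + int N" "a \<le> c" "c \<le> a + int N" "\<theta> (a - 1) + pi < \<theta> c"
      "{l \<in> Z. 0 \<le> Re (cnj w * z l)} = g ` {a..<c}"
    by (rule halfplane_run)
  \<comment> \<open>A run has at most \<open>N\<close> indices, so \<open>g\<close> is injective on
    it and surviving points can be counted by indices.\<close>
  have *: "k - 1 \<le> card {l \<in> Z - T. 0 \<le> Re (cnj w * z l)}"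
    if X: "X \<subseteq> {a..<c}" "\<And>x. x \<in> X \<Longrightarrow> g x \<notin> T" "k - 1 \<le> card X" for X
  proof -
    have "g ` X \<subseteq> {l \<in> Z - T. 0 \<le> Re (cnj w * z l)}"
      using X(1,2) ac(6) by blast
    then have "card (g ` X) \<le> card {l \<in> Z - T. 0 \<le> Re (cnj w * z l)}"
      using finite_Z by (intro card_mono) auto
    moreover have "inj_on g X"
      using X(1) ac(4) by (intro inj_on_subset[OF inj_g[of a]]) auto
    ultimately show ?thesis using X(3) by (simp add: card_image)
  qed
  show "k - 1 \<le> card {l \<in> Z - T. 0 \<le> Re (cnj w * z l)}"
  proof (cases "a = i + 1")
    case True
    then have "i + int k + 1 < c"
      using good ac(5) by (intro \<theta>_less_imp) simp
    obtain s t where st: "{x \<in> {i + 1..i + 1 + int k}. g x \<in> T} \<subseteq> {s, t}" using two by blast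
    show ?thesis
    proof (rule *[of "{i + 1..i + 1 + int k} - {s, t}"])
      have "card {i + 1..i + 1 + int k} - card {s, t} \<le> card ({i + 1..i + 1 + int k} - {s, t})"
        by (intro diff_card_le_card_Diff) auto
      moreover have "card {s, t} \<le> 2" by (simp add: card_insert_if)
      ultimately show "k - 1 \<le> card ({i + 1..i + 1 + int k} - {s, t})" by simp
    qed (use True st \<open>i + int k + 1 < c\<close> in auto)
  next
    case False
    then obtain t where t: "{x \<in> {a..<a + int k}. g x \<in> T} \<subseteq> {t}" using one[of a] ac by auto
    have "a - 1 + int k < c"
      using gap[of "a - 1"] ac(5) by (intro \<theta>_less_imp) simp
    then show ?thesis
      using t by (intro *[of "{a..<a + int k} - {t}"]) (auto simp: card_Diff_singleton_if)
  qed
qed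

section \<open>Splitting off a triangle, and the case of five points\<close>

text \<open>Three indices with cyclic gaps \<open>k - 1\<close>, \<open>k\<close>, \<open>k\<close>
  are removed. Every window of \<open>k\<close> indices contains one of them, and only the window
  spanning the short gap contains two. The short gap is put where \<open>depth_diffI\<close> allows
  a double loss; \<open>3 \<le> k\<close> guarantees that such a place exists.\<close>

lemma remove_triangle:
  assumes N: "N = 3 * k - 1" and "3 \<le> k" and "depth z Z k"
  obtains T where "T \<subseteq> Z" "card T = 3" "depth z T 1" "depth z (Z - T) (k - 1)"
proof -
  have N': "int N = 3 * int k - 1" using N assms(2) by auto
  have gap: "\<theta> (j + int k) \<le> \<theta> j + pi" for j
    using assms(3) depth_gap by blast
  \<comment> \<open>\<open>2(k + 1) \<le> N\<close>, so two consecutive steps of \<open>k + 1\<close> indices make at most a full turn\<close>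
  obtain i where good: "\<theta> (i + int k + 1) \<le> \<theta> i + pi"
  proof (cases "\<theta> (0 + int k + 1) \<le> \<theta> 0 + pi")
    case False
    have "\<theta> ((int k + 1) + int k + 1) \<le> \<theta> (0 + int N)"
      using N' assms(2) by (intro \<theta>_le) auto
    then have "\<theta> ((int k + 1) + int k + 1) \<le> \<theta> (int k + 1) + pi"
      using False \<theta>_period[of 0] by auto
    then show ?thesis using that by blast
  qed (use that in blast)
  define T where "T = g ` {i + 1, i + int k, i + 2 * int k}"
  \<comment> \<open>Two periods are listed, because a window that starts in the first may run into
    the second. With \<open>N = 3 * k - 1\<close>, the last three indices are the first three
    shifted by \<open>N\<close>.\<close>
  have T_iff: "g x \<in> T \<longleftrightarrow> x \<in>
      {i + 1, i + int k, i + 2 * int k, i + 3 * int k, i + 4 * int k - 1, i + 5 * int k - 1}"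
    if "i + 1 \<le> x" "x < i + 1 + 2 * int N" for x
  proof -
    have e: "g x = g y \<longleftrightarrow> x = y \<or> x = y + int N" if y: "i + 1 \<le> y" "y < i + 1 + int N" for y
    proof (cases "x < i + 1 + int N")
      case True
      then show ?thesis using inj_onD[OF inj_g[of "i + 1"], of x y] y \<open>i + 1 \<le> x\<close> by auto
    next
      case False
      then show ?thesis
        using inj_onD[OF inj_g[of "i + 1"], of "x - int N" y] y \<open>x < i + 1 + 2 * int N\<close>
          g_period[of "x - int N"] g_period[of y] by auto
    qed
    show ?thesis
      unfolding T_def using e[of "i + 1"] e[of "i + int k"] e[of "i + 2 * int k"] N' assms(2) by auto
  qed
  show thesis
  proof (rule that)
    show "T \<subseteq> Z" using g_in by (auto simp: T_def)
    have "inj_on g {i + 1, i + int k, i + 2 * int k}"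
      using N' assms(2) by (intro inj_on_subset[OF inj_g[of "i + 1"]]) auto
    then show "card T = 3"
      using assms(2) by (simp add: T_def card_image)
    then show "depth z T 1"
    proof (intro depth_1I[where b = "i + 1" and k = k] \<open>T \<subseteq> Z\<close> gap)
      fix a assume a: "i + 1 \<le> a" "a < i + 1 + int N"
      have "\<exists>t\<in>{a..<a + int k}. g t \<in> T"
      proof -
        consider "a = i + 1" | "i + 1 < a" "a \<le> i + int k" | "i + int k < a" "a \<le> i + 2 * int k"
          | "i + 2 * int k < a" "a \<le> i + 3 * int k" using a N' by linarith
        then show ?thesis
        proof cases
          case 1 then show ?thesis using T_iff[of a] N' assms(2) by (intro bexI[of _ a]) auto
        next
          case 2 then show ?thesis using T_iff[of "i + int k"] N' assms(2)
            by (intro bexI[of _ "i + int k"]) auto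
        next
          case 3 then show ?thesis using T_iff[of "i + 2 * int k"] N' assms(2)
            by (intro bexI[of _ "i + 2 * int k"]) auto
        next
          case 4 then show ?thesis using T_iff[of "i + 3 * int k"] N' assms(2)
            by (intro bexI[of _ "i + 3 * int k"]) auto
        qed
      qed
      then show "g ` {a..<a + int k} \<inter> T \<noteq> {}" by blast
    qed
    show "depth z (Z - T) (k - 1)"
    proof (rule depth_diffI[OF gap good])
      have "{x \<in> {i + 1..i + 1 + int k}. g x \<in> T} \<subseteq> {i + 1, i + int k}"
        using T_iff N' assms(2) by auto
      then show "\<exists>s t. {x \<in> {i + 1..i + 1 + int k}. g x \<in> T} \<subseteq> {s, t}" by blast
      fix a assume a: "i + 2 \<le> a" "a \<le> i + int N"
      \<comment> \<open>The marked index following the one named in each case stays out of the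
        window. In the last case this is tight: \<open>a \<le> i + int N\<close> lets the window
        reach at most \<open>i + 4 * int k - 2\<close>.\<close>
      consider "a \<le> i + int k" | "i + int k < a" "a \<le> i + 2 * int k"
        | "i + 2 * int k < a" "a \<le> i + 3 * int k" using a N' by linarith
      then show "\<exists>t. {x \<in> {a..<a + int k}. g x \<in> T} \<subseteq> {t}"
      proof cases
        case 1
        then have "{x \<in> {a..<a + int k}. g x \<in> T} \<subseteq> {i + int k}"
          using T_iff a N' assms(2) by auto
        then show ?thesis by blast
      next
        case 2
        then have "{x \<in> {a..<a + int k}. g x \<in> T} \<subseteq> {i + 2 * int k}"
          using T_iff a N' assms(2) by auto
        then show ?thesis by blast
      next
        case 3
        then have "{x \<in> {a..<a + int k}. g x \<in> T} \<subseteq> {i + 3 * int k}"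
          using T_iff a N' assms(2) by auto
        then show ?thesis by blast
      qed
    qed
  qed
qed

text \<open>Two steps turn by at most a half-turn. Equality somewhere gives two points in opposite
  directions that can be split off; strictness everywhere yields the sign pattern of
  \<open>isotropic_pentagon\<close>.\<close>

lemma isotropic_five:
  assumes N: "N = 5" and depth: "depth z Z 2"
  shows "isotropic z Z 2"
proof -
  have gap: "\<theta> (j + int 2) \<le> \<theta> j + pi" for j
    using depth_gap[OF depth] by blast
  show ?thesis
  proof (cases "\<exists>j. \<theta> (j + 2) = \<theta> j + pi")
    case True
    then obtain j where j: "\<theta> (j + 2) = \<theta> j + pi" by blast
    define T where "T = g ` {j, j + 2}"
    have T_iff: "g x \<in> T \<longleftrightarrow> x \<in> {j, j + 2, j + 5, j + 7}" if "j \<le> x" "x < j + 10" for x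
    proof -
      have e: "g x = g y \<longleftrightarrow> x = y \<or> x = y + 5" if y: "j \<le> y" "y < j + 5" for y
      proof (cases "x < j + 5")
        case True
        then show ?thesis using inj_onD[OF inj_g[of "j"], of x y] y \<open>j \<le> x\<close> N by auto
      next
        case False
        then show ?thesis
          using inj_onD[OF inj_g[of "j"], of "x - 5" y] y \<open>x < j + 10\<close>
            g_period[of "x - int N"] g_period[of y] N by auto
      qed
      show ?thesis
        unfolding T_def using e[of j] e[of "j + 2"] by auto
    qed
    have "T \<subseteq> Z" using g_in by (auto simp: T_def)
    \<comment> \<open>The indices \<open>j\<close> and \<open>j + 2\<close> are not adjacent modulo
      5, so two consecutive indices never both belong to \<open>T\<close>.\<close>
    have "depth z (Z - T) 1"
    proof (rule depth_1I[where b = j and k = 2, OF _ _ gap])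
      fix a assume "j \<le> a" "a < j + int N"
      then have "a = j \<or> a = j + 1 \<or> a = j + 2 \<or> a = j + 3 \<or> a = j + 4" using N by auto
      then have "g a \<notin> T \<or> g (a + 1) \<notin> T" using T_iff by auto
      moreover have "{a, a + 1} \<subseteq> {a..<a + int 2}" by auto
      ultimately show "g ` {a..<a + int 2} \<inter> (Z - T) \<noteq> {}" using g_in by blast
    qed auto
    moreover have "depth z T 1"
      unfolding depth_def
    proof (intro allI impI)
      fix w :: complex
      have "sgn (z (g (j + 2))) = - sgn (z (g j))"
        by (simp add: polar j complex_eq_iff)
      then have "0 \<le> Re (cnj w * sgn (z (g j))) \<or> 0 \<le> Re (cnj w * sgn (z (g (j + 2))))"
        by auto
      moreover have "Re (cnj w * sgn x) = Re (cnj w * x) / cmod x" for x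
        by (simp add: sgn_eq)
      ultimately have "0 \<le> Re (cnj w * z (g j)) \<or> 0 \<le> Re (cnj w * z (g (j + 2)))"
        using nonzero g_in by (auto simp: zero_le_divide_iff)
      then have "{l \<in> T. 0 \<le> Re (cnj w * z l)} \<noteq> {}" by (auto simp: T_def)
      then show "1 \<le> card {l \<in> T. 0 \<le> Re (cnj w * z l)}"
        by (simp add: Suc_le_eq card_gt_0_iff T_def)
    qed
    ultimately have "isotropic z (T \<union> (Z - T)) (1 + 1)"
      using finite_Z finite_subset[OF \<open>T \<subseteq> Z\<close>] by (intro isotropic_Un isotropic_1_of_depth) auto
    then show ?thesis using \<open>T \<subseteq> Z\<close> by (simp add: Un_absorb1 numeral_2_eq_2)
  next
    case False
    then have lt: "\<theta> (j + 2) < \<theta> j + pi" for j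
      using gap[of j] by (simp add: order_less_le)
    \<comment> \<open>Three steps are the complement of two in a full turn of five.\<close>
    have gt: "\<theta> j + pi < \<theta> (j + 3)" for j
      using lt[of "j + 3"] \<theta>_period[of j] N by (simp add: add.assoc)
    \<comment> \<open>Three steps from \<open>j\<close> and two steps from \<open>j + 1\<close> both
      end at \<open>j + 3\<close>.\<close>
    have lt1: "\<theta> j < \<theta> (j + 1)" for j
      using gt[of j] lt[of "j + 1"] by (simp add: add.assoc)
    have cr: "cross (z (g i)) (z (g j)) = cmod (z (g i)) * cmod (z (g j)) * sin (\<theta> j - \<theta> i)" for i j
    proof -
      have "z (g i) = cmod (z (g i)) * cis (\<theta> i)" for i
        using polar[of i] nonzero[OF g_in[of i]] by (simp add: sgn_eq field_simps)
      then have "cross (z (g i)) (z (g j)) = cross (cmod (z (g i)) * cis (\<theta> i)) (cmod (z (g j)) * cis (\<theta> j))"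
        by metis
      then show ?thesis by (simp add: cross_def sin_diff algebra_simps)
    qed
    have p: "0 < cross (z (g i)) (z (g j))" if "0 < \<theta> j - \<theta> i" "\<theta> j - \<theta> i < pi" for i j
      using that sin_gt_zero[OF that] nonzero[OF g_in] by (simp add: cr)
    have n: "cross (z (g i)) (z (g j)) < 0" if "pi < \<theta> j - \<theta> i" "\<theta> j - \<theta> i < 2 * pi" for i j
      using that sin_lt_zero[OF that] nonzero[OF g_in] by (simp add: cr mult_pos_neg)
    have "isotropic (\<lambda>j. z (g j)) {0..<5} 2"
      by (rule isotropic_pentagon)
        (use lt[of 0] lt[of 1] lt[of 2] gt[of 0] gt[of 1] lt1[of 0] lt1[of 1] lt1[of 2] lt1[of 3]
          lt1[of 4] \<theta>_period[of 0] N in \<open>auto intro!: p n\<close>)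
    then show ?thesis using isotropic_reindex[OF bij_g] N by simp
  qed
qed

end

section \<open>Existence of the cyclic listing, and the induction on \<open>k\<close>\<close>

text \<open>The indices are sorted by principal argument and repeated periodically, adding
  \<open>2 * pi\<close> per round. The order on the index type supplies the initial list.\<close>

lemma cyclic_order_exists:
  fixes z :: "'i::linorder \<Rightarrow> complex"
  assumes "finite Z" "Z \<noteq> {}" "\<And>l. l \<in> Z \<Longrightarrow> z l \<noteq> 0"
  obtains g \<theta> where "cyclic_order z Z (card Z) g \<theta>"
proof -
  define N where "N = card Z"
  define xs where "xs = sort_key (\<lambda>l. Arg (z l)) (sorted_list_of_set Z)"
  have xs: "set xs = Z" "distinct xs" "length xs = N" "sorted (map (\<lambda>l. Arg (z l)) xs)"
    using assms(1) by (simp_all add: xs_def N_def)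
  define g where "g j = xs ! nat (j mod int N)" for j :: int
  define \<theta> where "\<theta> j = Arg (z (g j)) + 2 * pi * (j div int N)" for j :: int
  have N: "0 < N" using assms by (simp add: N_def card_gt_0_iff)
  have idx: "nat (j mod int N) < N" for j using N by (simp add: nat_less_iff)
  have gZ: "g j \<in> Z" for j
    using idx[of j] xs by (auto simp: g_def)
  have "cyclic_order z Z N g \<theta>"
  proof
    show "mono \<theta>"
    proof (rule monoI)
      fix i j :: int assume "i \<le> j"
      then consider "i div int N = j div int N" "i mod int N \<le> j mod int N"
        | "i div int N + 1 \<le> j div int N"
        using N zdiv_mono1[of i j "int N"]
        by (metis add_le_cancel_left of_nat_0_less_iff mult_div_mod_eq order_le_less zless_iff_Suc_zadd zless_add1_eq add1_zle_eq)
      then show "\<theta> i \<le> \<theta> j"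
      proof cases
        case 1
        then have "Arg (z (g i)) \<le> Arg (z (g j))"
          using xs(3) idx sorted_nth_mono[OF xs(4), of "nat (i mod int N)" "nat (j mod int N)"]
          by (simp add: g_def nat_mono)
        then show ?thesis using 1 by (simp add: \<theta>_def)
      next
        case 2
        \<comment> \<open>Principal arguments differ by less than \<open>2 * pi\<close>, so a later
          round outweighs them.\<close>
        then have "real_of_int (i div int N) + 1 \<le> real_of_int (j div int N)" by linarith
        then have "2 * pi * (real_of_int (i div int N) + 1) \<le> 2 * pi * real_of_int (j div int N)"
          by (intro mult_left_mono) auto
        then show ?thesis
          using Arg_bounded[of "z (g i)"] Arg_bounded[of "z (g j)"] by (simp add: \<theta>_def algebra_simps)
      qed
    qed
    show "bij_betw g {0..<int N} Z"
    proof (rule bij_betw_imageI)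
      show "inj_on g {0..<int N}"
        using xs by (auto simp: inj_on_def g_def nth_eq_iff_index_eq)
      show "g ` {0..<int N} = Z"
      proof
        show "Z \<subseteq> g ` {0..<int N}"
        proof
          fix l assume "l \<in> Z"
          then obtain n where "n < N" "l = xs ! n" using xs by (metis in_set_conv_nth)
          then show "l \<in> g ` {0..<int N}" by (intro image_eqI[of _ _ "int n"]) (auto simp: g_def)
        qed
      qed (use gZ in auto)
    qed
    fix j
    show "sgn (z (g j)) = cis (\<theta> j)"
      using cis_Arg[of "z (g j)"] assms(3)[OF gZ[of j]] by (simp add: \<theta>_def cis_plus_2pi_int)
  qed (use N assms in \<open>auto simp: \<theta>_def g_def algebra_simps\<close>)
  then show thesis using that by (simp add: N_def)
qed

text \<open>Each triangle contributes one isotropic vector and takes three points, which preserves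
  the count \<open>3 * k - 1\<close>. The base is five points because \<open>remove_triangle\<close>
  starts at 3.\<close>

lemma isotropic_of_depth:
  fixes z :: "'i::linorder \<Rightarrow> complex"
  assumes "2 \<le> k" "finite Z" "card Z = 3 * k - 1" "\<And>l. l \<in> Z \<Longrightarrow> z l \<noteq> 0" "depth z Z k"
  shows "isotropic z Z k"
  using assms
proof (induction k arbitrary: Z rule: dec_induct)
  case base
  have "Z \<noteq> {}" using base.prems(2) by auto
  then obtain g \<theta> where "cyclic_order z Z (card Z) g \<theta>"
    using cyclic_order_exists[of Z z] base.prems(1,3) by blast
  then show ?case
    by (rule cyclic_order.isotropic_five) (use base.prems in simp_all)
next
  case (step k)
  have "Z \<noteq> {}" using step.prems(2) by auto
  then obtain g \<theta> where c: "cyclic_order z Z (card Z) g \<theta>"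
    using cyclic_order_exists[of Z z] step.prems(1,3) by blast
  have "3 \<le> Suc k" using step.hyps by simp
  obtain T where T: "T \<subseteq> Z" "card T = 3" "depth z T 1" "depth z (Z - T) (Suc k - 1)"
    by (rule cyclic_order.remove_triangle[OF c step.prems(2) \<open>3 \<le> Suc k\<close> step.prems(4)])
  have fin: "finite T" "finite (Z - T)"
    using finite_subset[OF T(1) step.prems(1)] step.prems(1) by simp_all
  have "isotropic z (Z - T) k"
  proof (rule step.IH[OF fin(2)])
    show "card (Z - T) = 3 * k - 1"
      using T(1,2) fin(1) step.prems(2) by (simp add: card_Diff_subset)
  qed (use step.prems(3) T(4) in auto)
  then have "isotropic z (T \<union> (Z - T)) (1 + k)"
    using fin T(3) by (intro isotropic_Un isotropic_1_of_depth) auto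
  then show ?case using T(1) by (simp add: Un_absorb1)
qed

section \<open>Compressions of a unitary matrix\<close>

lemma index_mult_mat_sum:
  assumes "A \<in> carrier_mat n m" "B \<in> carrier_mat m l" "i < n" "j < l"
  shows "(A * B) $$ (i, j) = (\<Sum>k<m. A $$ (i, k) * B $$ (k, j))"
  using assms by (auto simp: scalar_prod_def atLeast0LessThan)

lemma mat_adjoint_carrier [simp]: "A \<in> carrier_mat n m \<Longrightarrow> mat_adjoint A \<in> carrier_mat m n"
  by (auto simp: mat_adjoint_def)

lemma mat_adjoint_index [simp]:
  "A \<in> carrier_mat n m \<Longrightarrow> i < m \<Longrightarrow> j < n \<Longrightarrow> mat_adjoint A $$ (i, j) = conjugate (A $$ (j, i))"
  by (auto simp: mat_adjoint_def mat_of_rows_index)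

lemma mat_adjoint_dim [simp]:
  "dim_row (mat_adjoint A) = dim_col A" "dim_col (mat_adjoint A) = dim_row A"
  by (auto simp: mat_adjoint_def)

lemma mat_adjoint_mult:
  fixes A B :: "complex mat"
  assumes "A \<in> carrier_mat n m" "B \<in> carrier_mat m l"
  shows "mat_adjoint (A * B) = mat_adjoint B * mat_adjoint A"
proof (rule eq_matI)
  have d: "dim_row (mat_adjoint B * mat_adjoint A) = l" "dim_col (mat_adjoint B * mat_adjoint A) = n"
    using carrier_matD[OF assms(1)] carrier_matD[OF assms(2)] by simp_all
  show "dim_row (mat_adjoint (A * B)) = dim_row (mat_adjoint B * mat_adjoint A)"
    "dim_col (mat_adjoint (A * B)) = dim_col (mat_adjoint B * mat_adjoint A)"
    using carrier_matD[OF assms(1)] carrier_matD[OF assms(2)] by auto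
  fix i j assume "i < dim_row (mat_adjoint B * mat_adjoint A)" "j < dim_col (mat_adjoint B * mat_adjoint A)"
  then have ij: "i < l" "j < n" using d by auto
  have "mat_adjoint (A * B) $$ (i, j) = cnj (\<Sum>k<m. A $$ (j, k) * B $$ (k, i))"
    using ij carrier_matD[OF assms(1)] carrier_matD[OF assms(2)]
    by (simp add: mat_adjoint_index[OF mult_carrier_mat[OF assms]] scalar_prod_def atLeast0LessThan)
  also have "\<dots> = (\<Sum>k<m. mat_adjoint B $$ (i, k) * mat_adjoint A $$ (k, j))"
    using ij by (simp add: mat_adjoint_index[OF assms(1)] mat_adjoint_index[OF assms(2)] mult.commute)
  also have "\<dots> = (mat_adjoint B * mat_adjoint A) $$ (i, j)"
    using ij carrier_matD[OF assms(1)] carrier_matD[OF assms(2)]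
    by (simp add: scalar_prod_def atLeast0LessThan)
  finally show "mat_adjoint (A * B) $$ (i, j) = (mat_adjoint B * mat_adjoint A) $$ (i, j)" .
qed

lemma mat_adjoint_adjoint:
  fixes A :: "complex mat"
  assumes "A \<in> carrier_mat n m"
  shows "mat_adjoint (mat_adjoint A) = A"
  using assms
  by (intro eq_matI) (auto simp: mat_adjoint_index[OF mat_adjoint_carrier[OF assms]] mat_adjoint_index[OF assms])

definition diag_of :: "'a::zero list \<Rightarrow> 'a mat" where
  "diag_of es = mat (length es) (length es) (\<lambda>(i, j). if i = j then es ! i else 0)"

lemma diag_of_carrier [simp]: "length es = n \<Longrightarrow> diag_of es \<in> carrier_mat n n"
  by (auto simp: diag_of_def)

lemma mult_diag_of_right:
  fixes A :: "complex mat"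
  assumes "A \<in> carrier_mat m n" "length es = n" "i < m" "j < n"
  shows "(A * diag_of es) $$ (i, j) = A $$ (i, j) * es ! j"
proof -
  have "(A * diag_of es) $$ (i, j) = (\<Sum>k<n. A $$ (i, k) * (if k = j then es ! k else 0))"
    using assms by (auto simp: diag_of_def scalar_prod_def atLeast0LessThan intro!: sum.cong)
  also have "\<dots> = A $$ (i, j) * es ! j"
    using assms(4) by (simp add: if_distrib[of "\<lambda>x. _ * x"] sum.delta cong: if_cong)
  finally show ?thesis .
qed

lemma mult_diag_of_left:
  fixes A :: "complex mat"
  assumes "A \<in> carrier_mat n m" "length es = n" "i < n" "j < m"
  shows "(diag_of es * A) $$ (i, j) = es ! i * A $$ (i, j)"
proof -
  have "(diag_of es * A) $$ (i, j) = (\<Sum>k<n. (if i = k then es ! i else 0) * A $$ (k, j))"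
    using assms by (auto simp: diag_of_def scalar_prod_def atLeast0LessThan intro!: sum.cong)
  also have "\<dots> = es ! i * A $$ (i, j)"
    using assms(3) by (simp add: if_distrib[of "\<lambda>x. x * _"] sum.delta' cong: if_cong)
  finally show ?thesis .
qed

section \<open>Unitary diagonalization\<close>

text \<open>For a matrix \<open>Q\<close> of unit eigenvectors with Gram matrix \<open>G\<close>,
  unitarity of \<open>U\<close> multiplies \<open>G $$ (i, j)\<close> by
  \<open>cnj (es ! i) * es ! j\<close> without changing it. The diagonal entries put the eigenvalues
  on the unit circle, and distinctness then kills the off-diagonal ones.\<close>

lemma unitary_diagonalization:
  assumes U: "U \<in> carrier_mat n n" "unitary_mat U"
    and es: "distinct es" "length es = n" "\<And>e. e \<in> set es \<Longrightarrow> eigenvalue U e"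
  obtains Q where "Q \<in> carrier_mat n n" "mat_adjoint Q * Q = 1\<^sub>m n" "Q * mat_adjoint Q = 1\<^sub>m n"
    "U = Q * diag_of es * mat_adjoint Q" "\<And>e. e \<in> set es \<Longrightarrow> cnj e * e = 1"
proof -
  have "\<exists>v. eigenvector U v (es ! i) \<and> (\<Sum>r<n. cnj (v $ r) * v $ r) = 1" if "i < n" for i
  proof -
    have "eigenvalue U (es ! i)" using es(2,3) that by simp
    then obtain v where v: "eigenvector U v (es ! i)" unfolding eigenvalue_def by blast
    then have vc: "v \<in> carrier_vec n" "v \<noteq> 0\<^sub>v n" "U *\<^sub>v v = (es ! i) \<cdot>\<^sub>v v"
      using U by (auto simp: eigenvector_def)
    define s where "s = (\<Sum>r<n. (cmod (v $ r))\<^sup>2)"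
    obtain r where r: "r < n" "v $ r \<noteq> 0"
      using vc by (metis carrier_vecD eq_vecI index_zero_vec(1) index_zero_vec(2))
    have s: "0 < s" unfolding s_def using r by (intro sum_pos2[where i = r]) auto
    define c where "c = complex_of_real (1 / sqrt s)"
    have c: "c \<noteq> 0" "cnj c * c = 1 / s" using s by (simp_all add: c_def flip: of_real_mult)
    have "eigenvector U (c \<cdot>\<^sub>v v) (es ! i)"
    proof -
      have "c \<cdot>\<^sub>v v \<noteq> 0\<^sub>v n"
        using r c(1) vc(1) by (auto dest!: arg_cong[of _ _ "\<lambda>w. w $ r"])
      moreover have "U *\<^sub>v (c \<cdot>\<^sub>v v) = (es ! i) \<cdot>\<^sub>v (c \<cdot>\<^sub>v v)"
        using U vc by (simp add: mult_mat_vec smult_smult_assoc mult.commute)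
      ultimately show ?thesis using U vc by (simp add: eigenvector_def)
    qed
    moreover have "(\<Sum>r<n. cnj ((c \<cdot>\<^sub>v v) $ r) * (c \<cdot>\<^sub>v v) $ r) = 1"
    proof -
      have "(\<Sum>r<n. cnj ((c \<cdot>\<^sub>v v) $ r) * (c \<cdot>\<^sub>v v) $ r) = (\<Sum>r<n. (cnj c * c) * of_real ((cmod (v $ r))\<^sup>2))"
        using vc(1) by (intro sum.cong refl) (simp add: algebra_simps flip: complex_norm_square)
      also have "\<dots> = (cnj c * c) * of_real s" by (simp add: s_def sum_distrib_left)
      also have "\<dots> = 1" using s c(2) by simp
      finally show ?thesis .
    qed
    ultimately show ?thesis by blast
  qed
  then obtain q where q: "\<And>i. i < n \<Longrightarrow> eigenvector U (q i) (es ! i)"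
      "\<And>i. i < n \<Longrightarrow> (\<Sum>r<n. cnj (q i $ r) * q i $ r) = 1"
    by metis
  have qc: "q i \<in> carrier_vec n" "U *\<^sub>v q i = (es ! i) \<cdot>\<^sub>v q i" if "i < n" for i
    using q(1)[OF that] U by (auto simp: eigenvector_def)
  define Q where "Q = mat n n (\<lambda>(r, i). q i $ r)"
  have Q: "Q \<in> carrier_mat n n" by (simp add: Q_def)
  have colQ: "col Q i = q i" if "i < n" for i
    using qc(1)[OF that] that by (intro eq_vecI) (auto simp: Q_def)
  have D: "diag_of es \<in> carrier_mat n n" using es by simp
  note QQ = mat_adjoint_carrier[OF Q]
  note DD = mat_adjoint_carrier[OF D]
  note UU = mat_adjoint_carrier[OF U(1)]
  have UQ: "U * Q = Q * diag_of es"
  proof (rule eq_matI)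
    fix i j assume "i < dim_row (Q * diag_of es)" "j < dim_col (Q * diag_of es)"
    then have ij: "i < n" "j < n" using es by (auto simp: Q_def diag_of_def)
    have "(U * Q) $$ (i, j) = (U *\<^sub>v q j) $ i"
      using carrier_matD[OF U(1)] carrier_matD[OF Q] ij by (simp add: colQ)
    also have "\<dots> = (Q * diag_of es) $$ (i, j)"
      using ij qc[OF ij(2)] es by (simp add: mult_diag_of_right[OF Q]) (simp add: Q_def)
    finally show "(U * Q) $$ (i, j) = (Q * diag_of es) $$ (i, j)" .
  qed (use carrier_matD[OF U(1)] carrier_matD[OF Q] carrier_matD[OF D] in simp_all)
  have UU1: "mat_adjoint U * U = 1\<^sub>m n" using U by (auto simp: unitary_mat_def)
  define G where "G = mat_adjoint Q * Q"
  have G: "G \<in> carrier_mat n n" by (simp add: G_def mult_carrier_mat[OF QQ Q])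
  have "mat_adjoint U * (U * Q) = Q"
    using assoc_mult_mat[OF UU U(1) Q] UU1 Q by simp
  then have "mat_adjoint (U * Q) * (U * Q) = G"
    using assoc_mult_mat[OF QQ UU mult_carrier_mat[OF U(1) Q]]
    by (simp add: mat_adjoint_mult[OF U(1) Q] G_def)
  moreover have "mat_adjoint (Q * diag_of es) * (Q * diag_of es) = mat_adjoint (diag_of es) * (G * diag_of es)"
    using assoc_mult_mat[OF DD QQ mult_carrier_mat[OF Q D]] assoc_mult_mat[OF QQ Q D]
    by (simp add: mat_adjoint_mult[OF Q D] G_def)
  ultimately have GD: "mat_adjoint (diag_of es) * (G * diag_of es) = G" by (simp add: UQ)
  have adjD: "mat_adjoint (diag_of es) = diag_of (map cnj es)"
  proof (rule eq_matI)
    fix i j assume "i < dim_row (diag_of (map cnj es))" "j < dim_col (diag_of (map cnj es))"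
    then have ij: "i < n" "j < n" using es(2) by (simp_all add: diag_of_def)
    show "mat_adjoint (diag_of es) $$ (i, j) = diag_of (map cnj es) $$ (i, j)"
      unfolding mat_adjoint_index[OF D ij] using ij es(2) by (auto simp: diag_of_def)
  qed (use es(2) in \<open>simp_all add: diag_of_def\<close>)
  have Gij: "cnj (es ! i) * (G $$ (i, j) * es ! j) = G $$ (i, j)" if "i < n" "j < n" for i j
  proof -
    have "(mat_adjoint (diag_of es) * (G * diag_of es)) $$ (i, j) = cnj (es ! i) * (G $$ (i, j) * es ! j)"
      unfolding adjD using that es(2) mult_carrier_mat[OF G D]
      by (simp add: mult_diag_of_left[of _ n n] mult_diag_of_right[OF G])
    then show ?thesis by (simp add: GD)
  qed
  have Gii: "G $$ (i, i) = 1" if "i < n" for i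
    using that q(2)[OF that] carrier_matD[OF Q] unfolding G_def
    by (simp add: scalar_prod_def atLeast0LessThan mat_adjoint_index[OF Q]) (simp add: Q_def)
  have unit: "cnj (es ! i) * es ! i = 1" if "i < n" for i
    using Gij[OF that that] Gii[OF that] by simp
  have G1: "G = 1\<^sub>m n"
  proof (rule eq_matI)
    fix i j assume "i < dim_row (1\<^sub>m n :: complex mat)" "j < dim_col (1\<^sub>m n :: complex mat)"
    then have ij: "i < n" "j < n" by auto
    have "G $$ (i, j) = 0" if "i \<noteq> j"
    proof (rule ccontr)
      assume "G $$ (i, j) \<noteq> 0"
      then have "cnj (es ! i) * es ! j = 1" using Gij[OF ij] by (simp add: mult.left_commute)
      then have "es ! i = es ! j"
        using unit[OF ij(1)] by (metis mult.commute mult.left_commute mult_1_right)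
      then show False using es ij that by (simp add: nth_eq_iff_index_eq)
    qed
    then show "G $$ (i, j) = 1\<^sub>m n $$ (i, j)" using Gii ij by auto
  qed (use G in auto)
  have QQ1: "Q * mat_adjoint Q = 1\<^sub>m n"
    using mat_mult_left_right_inverse[OF QQ Q] G1 by (simp add: G_def)
  have "U = U * (Q * mat_adjoint Q)" using U by (simp add: QQ1)
  also have "\<dots> = Q * diag_of es * mat_adjoint Q"
    using assoc_mult_mat[OF U(1) Q QQ] by (simp add: UQ)
  finally have "U = Q * diag_of es * mat_adjoint Q" .
  moreover have "cnj e * e = 1" if "e \<in> set es" for e
    using that unit es by (metis in_set_conv_nth)
  ultimately show thesis using that Q G1 QQ1 by (simp add: G_def)
qed

section \<open>Projections and isometries\<close>

text \<open>Isometry makes the columns of \<open>W\<close> independent. Multiplying by the adjoint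
  keeps the column space, as the product fixes every vector \<open>W *\<^sub>v y\<close>.\<close>

lemma rank_isometry_mult_adjoint:
  fixes W :: "complex mat"
  assumes W: "W \<in> carrier_mat n k" and iso: "mat_adjoint W * W = 1\<^sub>m k"
  shows "vec_space.rank n (W * mat_adjoint W) = k"
proof -
  interpret vec_space "TYPE(complex)" n .
  note Wa = mat_adjoint_carrier[OF W]
  have inj: "v = 0\<^sub>v k" if "v \<in> carrier_vec k" "W *\<^sub>v v = 0\<^sub>v n" for v
  proof -
    have "v = (mat_adjoint W * W) *\<^sub>v v" using that by (simp add: iso)
    also have "\<dots> = mat_adjoint W *\<^sub>v (W *\<^sub>v v)" by (rule assoc_mult_mat_vec[OF Wa W that(1)])
    also have "\<dots> = 0\<^sub>v k" using that(2) carrier_matD[OF W] by (intro eq_vecI) (simp_all add: scalar_prod_def)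
    finally show ?thesis .
  qed
  have dist: "distinct (cols W)"
  proof (unfold distinct_conv_nth, intro allI impI notI)
    fix i j assume ij: "i < length (cols W)" "j < length (cols W)" "i \<noteq> j" "cols W ! i = cols W ! j"
    then have ij': "i < k" "j < k" using W by auto
    have "col W i = col W j" using ij by simp
    then have "(mat_adjoint W * W) $$ (i, i) = (mat_adjoint W * W) $$ (i, j)"
      using ij' W Wa by simp
    then show False using ij' ij(3) by (simp add: iso)
  qed
  have "lin_indpt (set (cols W))"
    using lin_depE[OF W _ dist] inj by metis
  then have "rank W = k" using lin_indpt_full_rank[OF W dist] by blast
  moreover have "col_space (W * mat_adjoint W) = col_space W"
  proof -
    have WW: "W * mat_adjoint W \<in> carrier_mat n n" using W Wa by simp
    have "\<exists>y\<in>carrier_vec k. W *\<^sub>v y = (W * mat_adjoint W) *\<^sub>v x" if "x \<in> carrier_vec n" for x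
      using assoc_mult_mat_vec[OF W Wa that] Wa that by (intro bexI[of _ "mat_adjoint W *\<^sub>v x"]) auto
    moreover have "\<exists>x\<in>carrier_vec n. (W * mat_adjoint W) *\<^sub>v x = W *\<^sub>v y" if "y \<in> carrier_vec k" for y
    proof (intro bexI[of _ "W *\<^sub>v y"])
      have "(W * mat_adjoint W) *\<^sub>v (W *\<^sub>v y) = W *\<^sub>v ((mat_adjoint W * W) *\<^sub>v y)"
        using W Wa that by (simp add: assoc_mult_mat_vec[of _ n k _ n] assoc_mult_mat_vec[of _ k n _ k])
      then show "(W * mat_adjoint W) *\<^sub>v (W *\<^sub>v y) = W *\<^sub>v y" using that by (simp add: iso)
    qed (use W that in auto)
    ultimately show ?thesis
      unfolding col_space_eq[OF W] col_space_eq[OF WW] using W by auto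
  qed
  ultimately show ?thesis unfolding rank_def col_space_def by simp
qed

text \<open>\<open>W * mat_adjoint W\<close> is the projection onto the range of the isometry
  \<open>W\<close>, and a scalar compression stays scalar when carried back by
  \<open>W\<close>.\<close>

lemma higher_rank_numerical_rangeI:
  assumes U: "U \<in> carrier_mat n n" and W: "W \<in> carrier_mat n k"
    and iso: "mat_adjoint W * W = 1\<^sub>m k" and compr: "mat_adjoint W * U * W = \<mu> \<cdot>\<^sub>m 1\<^sub>m k"
  shows "\<mu> \<in> higher_rank_numerical_range k U"
proof -
  note Wa [simp] = mat_adjoint_carrier[OF W]
  define P where "P = W * mat_adjoint W"
  have P: "P \<in> carrier_mat n n" using W by (simp add: P_def)
  have "P * P = W * (mat_adjoint W * W) * mat_adjoint W"
    unfolding P_def using W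
    by (simp add: assoc_mult_mat[of _ n k _ n _ n] assoc_mult_mat[of _ k n _ k _ n] assoc_mult_mat[of _ n k _ k _ n]
        mult_carrier_mat[of _ n k _ n] mult_carrier_mat[of _ k n _ n]
        mult_carrier_mat[of _ k n _ k] mult_carrier_mat[of _ n k _ k]
        mult_carrier_mat[of _ k k _ n])
  then have "P * P = P" using W by (simp add: iso P_def)
  moreover have "mat_adjoint P = P"
    unfolding P_def by (simp add: mat_adjoint_mult[OF W Wa] mat_adjoint_adjoint[OF W])
  moreover have "P * U * P = \<mu> \<cdot>\<^sub>m P"
  proof -
    have UW: "U * W \<in> carrier_mat n k" using U W by simp
    have "P * U * P = W * (mat_adjoint W * (U * W)) * mat_adjoint W"
      unfolding P_def using U W UW
      by (simp add: assoc_mult_mat[of _ n k _ n _ n] assoc_mult_mat[of _ k n _ n _ n]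
          assoc_mult_mat[of _ n n _ k _ n] assoc_mult_mat[of _ k n _ k _ n] assoc_mult_mat[of _ n k _ k _ n]
        mult_carrier_mat[of _ n k _ n] mult_carrier_mat[of _ k n _ n]
        mult_carrier_mat[of _ n n _ n] mult_carrier_mat[of _ n n _ k]
        mult_carrier_mat[of _ k n _ k] mult_carrier_mat[of _ n k _ k]
        mult_carrier_mat[of _ k k _ n])
    also have "mat_adjoint W * (U * W) = mat_adjoint W * U * W"
      using U W by (simp add: assoc_mult_mat[of _ k n _ n _ k]
        mult_carrier_mat[of _ k n _ n] mult_carrier_mat[of _ n n _ k])
    also have "W * (mat_adjoint W * U * W) * mat_adjoint W = \<mu> \<cdot>\<^sub>m P"
      unfolding compr P_def using W
      by (simp add: mult_smult_distrib[of _ n k _ k] mult_smult_assoc_mat[of _ n k _ n])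
    finally show ?thesis .
  qed
  moreover have "vec_space.rank n P = k"
    unfolding P_def by (rule rank_isometry_mult_adjoint[OF W iso])
  moreover have "dim_row U = n" "square_mat P" using carrier_matD[OF U] carrier_matD[OF P] by simp_all
  ultimately show ?thesis
    unfolding higher_rank_numerical_range_def orthogonal_projection_def using P by blast
qed

text \<open>The columns of \<open>A\<close> are a maximal independent set of columns of
  \<open>P\<close>; idempotence makes \<open>P\<close> fix each of its own columns.\<close>

lemma higher_rank_numerical_rangeE:
  assumes U: "U \<in> carrier_mat n n" and mu: "\<mu> \<in> higher_rank_numerical_range k U"
  obtains P A where "P \<in> carrier_mat n n" "A \<in> carrier_mat n k" "mat_adjoint P = P"
    "P * U * P = \<mu> \<cdot>\<^sub>m P" "P * A = A"
    "\<And>v. v \<in> carrier_vec k \<Longrightarrow> A *\<^sub>v v = 0\<^sub>v n \<Longrightarrow> v = 0\<^sub>v k"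
proof -
  interpret vec_space "TYPE(complex)" n .
  obtain P where P: "P \<in> carrier_mat n n" "P * P = P" "mat_adjoint P = P" "rank P = k" "P * U * P = \<mu> \<cdot>\<^sub>m P"
    using mu U unfolding higher_rank_numerical_range_def orthogonal_projection_def by auto
  have "lin_indpt {}" by (simp add: lin_dep_def)
  then obtain B where B: "maximal B (\<lambda>T. T \<subseteq> set (cols P) \<and> lin_indpt T)"
    using maximal_exists_superset[of "set (cols P)" "\<lambda>T. T \<subseteq> set (cols P) \<and> lin_indpt T" "{}"] by auto
  then have B': "B \<subseteq> set (cols P)" "lin_indpt B" "card B = k"
    using rank_card_indpt[OF P(1) B] P(4) by (auto simp: maximal_def)
  have "finite B" using B'(1) finite_subset by blast
  then obtain bs where bs: "set bs = B" "distinct bs" using finite_distinct_list by blast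
  have len: "length bs = k" using bs B'(3) distinct_card by metis
  have bsc: "set bs \<subseteq> carrier_vec n" using bs B'(1) cols_dim[of P] P(1) by auto
  define A where "A = mat_of_cols n bs"
  have A: "A \<in> carrier_mat n k" "cols A = bs" using len bsc by (auto simp: A_def)
  have "P * A = A"
  proof (rule mat_col_eqI)
    fix j assume "j < dim_col A"
    then have j: "j < k" using A by simp
    then have "col A j \<in> set (cols P)"
      using A B'(1) bs len by (metis carrier_matD(2) cols_nth nth_mem subsetD)
    then obtain i where i: "i < n" "col A j = col P i"
      using P(1) by (auto simp: in_set_conv_nth)
    have "col (P * A) j = P *\<^sub>v col P i" using col_mult2[OF P(1) A(1) j] i(2) by simp
    also have "\<dots> = col (P * P) i" using col_mult2[OF P(1) P(1) i(1)] by simp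
    finally show "col (P * A) j = col A j" using P(2) i by simp
  qed (use P A in auto)
  moreover have "v = 0\<^sub>v k" if "v \<in> carrier_vec k" "A *\<^sub>v v = 0\<^sub>v n" for v
    using lin_depI[OF A(1) that(1) _ that(2)] A(2) bs B'(2) by auto
  ultimately show thesis using that P A by blast
qed

section \<open>The higher-rank numerical range lies in \<open>Omega\<close>\<close>

text \<open>Zero rows pad the system to a square matrix. Row \<open>m\<close> is then zero, so the
  transpose kills \<open>unit_vec k m\<close> and the determinant vanishes.\<close>

lemma homogeneous_system_solution:
  fixes f :: "nat \<Rightarrow> nat \<Rightarrow> 'a :: field"
  assumes "m < k"
  obtains c where "c \<in> carrier_vec k" "c \<noteq> 0\<^sub>v k" "\<And>r. r < m \<Longrightarrow> (\<Sum>a<k. f r a * c $ a) = 0"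
proof -
  define M where "M = mat k k (\<lambda>(r, a). if r < m then f r a else 0)"
  have M: "M \<in> carrier_mat k k" by (simp add: M_def)
  have "transpose_mat M *\<^sub>v unit_vec k m = 0\<^sub>v k"
    using assms by (intro eq_vecI) (auto simp: M_def)
  moreover have "unit_vec k m \<noteq> (0\<^sub>v k :: 'a vec)"
    using assms by (metis index_unit_vec(1) index_zero_vec(1) zero_neq_one)
  ultimately have "det (transpose_mat M) = 0"
    using det_0_iff_vec_prod_zero_field[of "transpose_mat M" k] M unit_vec_carrier[of k m]
      transpose_carrier_mat[of M k k] by blast
  then obtain c where c: "c \<in> carrier_vec k" "c \<noteq> 0\<^sub>v k" "M *\<^sub>v c = 0\<^sub>v k"
    using det_0_iff_vec_prod_zero_field[OF M] det_transpose[OF M] by auto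
  have "(\<Sum>a<k. f r a * c $ a) = 0" if "r < m" for r
  proof -
    have "(\<Sum>a<k. f r a * c $ a) = (M *\<^sub>v c) $ r"
      using that assms c(1) by (simp add: M_def scalar_prod_def atLeast0LessThan)
    then show ?thesis using c(3) that assms by simp
  qed
  then show thesis using that c by blast
qed

lemma sum_cnj_mult_self: "(\<Sum>r<n. cnj (x r) * x r) = of_real (\<Sum>r<n. (cmod (x r))\<^sup>2)"
  by (simp add: mult.commute flip: complex_norm_square)

text \<open>The vector used is \<open>X = A * C\<close> in the range of \<open>P\<close>; its
  coordinates \<open>Y\<close> in the eigenbasis vanish outside \<open>S\<close>, and their
  normalized squared moduli are the convex weights.\<close>

lemma higher_rank_numerical_range_subset_Omega:
  assumes U: "U \<in> carrier_mat n n" and k: "1 \<le> k" "k \<le> n"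
    and Q: "Q \<in> carrier_mat n n" "mat_adjoint Q * Q = 1\<^sub>m n" "Q * mat_adjoint Q = 1\<^sub>m n"
    and es: "length es = n" "char_poly U = (\<Prod>e\<leftarrow>es. [:- e, 1:])"
    and diag: "U = Q * diag_of es * mat_adjoint Q"
  shows "higher_rank_numerical_range k U \<subseteq> Omega k U"
proof
  fix \<mu> assume "\<mu> \<in> higher_rank_numerical_range k U"
  then obtain P A where P: "P \<in> carrier_mat n n" "mat_adjoint P = P" "P * U * P = \<mu> \<cdot>\<^sub>m P"
    and A: "A \<in> carrier_mat n k" "P * A = A"
      "\<And>v. v \<in> carrier_vec k \<Longrightarrow> A *\<^sub>v v = 0\<^sub>v n \<Longrightarrow> v = 0\<^sub>v k"
    using higher_rank_numerical_rangeE[OF U] by blast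
  note Qa = mat_adjoint_carrier[OF Q(1)]
  have D: "diag_of es \<in> carrier_mat n n" using es by simp
  show "\<mu> \<in> Omega k U"
    unfolding Omega_eq_listing[OF U es(2)]
  proof clarify
    fix S assume S: "S \<subseteq> {..<n}" "card S = n - k + 1"
    have "finite S" using S(1) finite_subset by blast
    \<comment> \<open>The \<open>k - 1\<close> coordinates outside \<open>S\<close> impose one
      equation fewer than there are coefficients in \<open>c\<close>.\<close>
    have "card ({..<n} - S) = k - 1" using S k \<open>finite S\<close> by (simp add: card_Diff_subset)
    then obtain js where js: "set js = {..<n} - S" "length js = k - 1"
      using finite_distinct_list[of "{..<n} - S"] distinct_card by (metis finite_Diff finite_lessThan)
    obtain c where c: "c \<in> carrier_vec k" "c \<noteq> 0\<^sub>v k"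
      "\<And>r. r < k - 1 \<Longrightarrow> (\<Sum>a<k. (mat_adjoint Q * A) $$ (js ! r, a) * c $ a) = 0"
      by (rule homogeneous_system_solution[of "k - 1" k "\<lambda>r a. (mat_adjoint Q * A) $$ (js ! r, a)"])
        (use k in auto)
    \<comment> \<open>A one-column matrix lets the quadratic forms below be read as entry
      \<open>(0, 0)\<close> of a product.\<close>
    define C where "C = mat k 1 (\<lambda>(a, _). c $ a)"
    have C: "C \<in> carrier_mat k 1" by (simp add: C_def)
    define X where "X = A * C"
    have X: "X \<in> carrier_mat n 1" using A C by (simp add: X_def)
    note Xa = mat_adjoint_carrier[OF X]
    have PX: "P * X = X"
      unfolding X_def using A C P assoc_mult_mat[OF P(1) A(1) C] by simp
    define Y where "Y = mat_adjoint Q * X"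
    have Y: "Y \<in> carrier_mat n 1" using Qa X by (simp add: Y_def)
    note Ya = mat_adjoint_carrier[OF Y]
    have Y_adj: "mat_adjoint Y = mat_adjoint X * Q"
      using mat_adjoint_mult[OF Qa X] by (simp add: Y_def mat_adjoint_adjoint[OF Q(1)])
    define y where "y i = Y $$ (i, 0)" for i
    have zero: "y j = 0" if j: "j < n" "j \<notin> S" for j
    proof -
      obtain r where r: "r < k - 1" "js ! r = j" using js j by (metis DiffI in_set_conv_nth lessThan_iff)
      have "Y = (mat_adjoint Q * A) * C"
        unfolding Y_def X_def by (rule assoc_mult_mat[OF Qa A(1) C, symmetric])
      moreover have "mat_adjoint Q * A \<in> carrier_mat n k" using Qa A by simp
      ultimately have "y j = (\<Sum>a<k. (mat_adjoint Q * A) $$ (j, a) * c $ a)"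
        using j(1) C by (simp add: y_def index_mult_mat_sum[of _ n k _ 1] del: index_mult_mat(1))
          (simp add: C_def)
      then show ?thesis using c(3)[OF r(1)] r(2) by simp
    qed
    \<comment> \<open>Otherwise \<open>X\<close> would vanish, since \<open>Q\<close> is invertible,
      against the injectivity of \<open>A\<close>.\<close>
    have "Y \<noteq> 0\<^sub>m n 1"
    proof
      assume "Y = 0\<^sub>m n 1"
      then have "Q * Y = 0\<^sub>m n 1" using Q(1) by simp
      moreover have "Q * Y = X"
        unfolding Y_def using assoc_mult_mat[OF Q(1) Qa X] Q(3) X by simp
      ultimately have X0: "X = 0\<^sub>m n 1" by simp
      have "A *\<^sub>v c = 0\<^sub>v n"
      proof (rule eq_vecI)
        fix i assume "i < dim_vec (0\<^sub>v n :: complex vec)"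
        then have i: "i < n" by simp
        have "(A *\<^sub>v c) $ i = (\<Sum>a<k. A $$ (i, a) * c $ a)"
          using i A(1) c(1) by (auto simp: scalar_prod_def atLeast0LessThan)
        also have "\<dots> = X $$ (i, 0)"
          unfolding X_def using i by (simp add: index_mult_mat_sum[OF A(1) C] del: index_mult_mat(1))
            (simp add: C_def)
        finally show "(A *\<^sub>v c) $ i = 0\<^sub>v n $ i" using i by (simp add: X0)
      qed (use A(1) in auto)
      then show False using A(3) c by blast
    qed
    then obtain i where i: "i < n" "y i \<noteq> 0"
      using Y by (metis (no_types) carrier_matD eq_matI index_zero_mat less_one y_def)
    define s where "s = (\<Sum>i<n. (cmod (y i))\<^sup>2)"
    have s: "0 < s" unfolding s_def using i by (intro sum_pos2[where i = i]) auto
    have YY: "mat_adjoint Y * Y = mat_adjoint X * X"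
    proof -
      have "mat_adjoint Y * Y = mat_adjoint X * (Q * Y)"
        unfolding Y_adj by (rule assoc_mult_mat[OF Xa Q(1) Y])
      also have "Q * Y = X"
        unfolding Y_def using assoc_mult_mat[OF Q(1) Qa X] Q(3) X by simp
      finally show ?thesis .
    qed
    have UX: "U * X = Q * (diag_of es * Y)"
      unfolding diag Y_def using Q(1) D Qa X
      by (simp add: assoc_mult_mat[of _ n n _ n _ 1] assoc_mult_mat[of _ n n _ n _ n]
        mult_carrier_mat[of _ n n _ n] mult_carrier_mat[of _ n n _ 1])
    have "mat_adjoint Y * (diag_of es * Y) = mat_adjoint X * (U * X)"
      unfolding Y_adj UX by (rule assoc_mult_mat[OF Xa Q(1) mult_carrier_mat[OF D Y]])
    also have "\<dots> = mat_adjoint X * (P * U * P * X)"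
    proof -
      \<comment> \<open>As \<open>P\<close> is self-adjoint and fixes \<open>X\<close>, it may be
        inserted on both sides of \<open>U\<close>.\<close>
      have "mat_adjoint X = mat_adjoint X * P"
        using mat_adjoint_mult[OF P(1) X] PX P(2) by simp
      then have "mat_adjoint X * (U * X) = mat_adjoint X * P * (U * (P * X))" by (simp add: PX)
      also have "\<dots> = mat_adjoint X * (P * U * P * X)"
        using Xa P(1) U X
        by (simp add: assoc_mult_mat[of _ 1 n _ n _ 1] assoc_mult_mat[of _ n n _ n _ 1] assoc_mult_mat[of _ n n _ n _ n]
        mult_carrier_mat[of _ 1 n _ n] mult_carrier_mat[of _ n n _ 1] mult_carrier_mat[of _ n n _ n])
      finally show ?thesis .
    qed
    also have "\<dots> = \<mu> \<cdot>\<^sub>m (mat_adjoint Y * Y)"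
      unfolding P(3) YY using P(1) X Xa PX
      by (simp add: mult_smult_assoc_mat[of _ n n _ 1] mult_smult_distrib[of _ 1 n _ 1])
    finally have "(mat_adjoint Y * (diag_of es * Y)) $$ (0, 0) = (\<mu> \<cdot>\<^sub>m (mat_adjoint Y * Y)) $$ (0, 0)"
      by simp
    moreover have "(mat_adjoint Y * (diag_of es * Y)) $$ (0, 0) = (\<Sum>i<n. cnj (y i) * (es ! i * y i))"
    proof -
      have "(mat_adjoint Y * (diag_of es * Y)) $$ (0, 0) =
          (\<Sum>i<n. mat_adjoint Y $$ (0, i) * (diag_of es * Y) $$ (i, 0))"
        using index_mult_mat_sum[OF Ya mult_carrier_mat[OF D Y], of 0 0] by simp
      then show ?thesis
        by (simp add: mult_diag_of_left[OF Y es(1)] mat_adjoint_index[OF Y] y_def)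
    qed
    moreover have "(mat_adjoint Y * Y) $$ (0, 0) = of_real s"
    proof -
      have "(mat_adjoint Y * Y) $$ (0, 0) = (\<Sum>i<n. cnj (y i) * y i)"
        by (simp add: index_mult_mat_sum[OF Ya Y] mat_adjoint_index[OF Y] y_def del: index_mult_mat(1))
      then show ?thesis by (simp only: sum_cnj_mult_self s_def)
    qed
    ultimately have *: "(\<Sum>i<n. cnj (y i) * (es ! i * y i)) = \<mu> * of_real s"
      using carrier_matD[OF Y] by simp
    have "(\<Sum>i\<in>S. ((cmod (y i))\<^sup>2 / s) *\<^sub>R (es ! i)) = \<mu>"
    proof -
      have "(\<Sum>i<n. cnj (y i) * (es ! i * y i)) = (\<Sum>i<n. (cmod (y i))\<^sup>2 *\<^sub>R (es ! i))"
        by (intro sum.cong refl) (simp add: scaleR_conv_of_real complex_norm_square del: of_real_power)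
      also have "\<dots> = (\<Sum>i\<in>S. (cmod (y i))\<^sup>2 *\<^sub>R (es ! i))"
        using S(1) zero by (intro sum.mono_neutral_right) auto
      finally have "(\<Sum>i\<in>S. (cmod (y i))\<^sup>2 *\<^sub>R (es ! i)) = s *\<^sub>R \<mu>"
        using * by (simp add: scaleR_conv_of_real mult.commute)
      moreover have "(\<Sum>i\<in>S. ((cmod (y i))\<^sup>2 / s) *\<^sub>R (es ! i)) =
          (1 / s) *\<^sub>R (\<Sum>i\<in>S. (cmod (y i))\<^sup>2 *\<^sub>R (es ! i))"
        by (simp add: scaleR_sum_right)
      ultimately show ?thesis using s by simp
    qed
    moreover have "(\<Sum>i\<in>S. ((cmod (y i))\<^sup>2 / s) *\<^sub>R (es ! i)) \<in> convex hull ((\<lambda>j. es ! j) ` S)"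
    proof (rule convex_sum[OF \<open>finite S\<close> convex_convex_hull])
      have "s = (\<Sum>i\<in>S. (cmod (y i))\<^sup>2)"
        unfolding s_def using S(1) zero by (intro sum.mono_neutral_right) auto
      then show "(\<Sum>i\<in>S. (cmod (y i))\<^sup>2 / s) = 1" using s by (simp flip: sum_divide_distrib)
    qed (use s in \<open>auto intro: hull_inc\<close>)
    ultimately show "\<mu> \<in> convex hull ((\<lambda>j. es ! j) ` S)" by simp
  qed
qed

section \<open>\<open>Omega\<close> lies in the higher-rank numerical range\<close>

text \<open>If fewer than \<open>k\<close> eigenvalues lay in a closed half-plane with
  \<open>\<mu>\<close> on its boundary, some \<open>n - k + 1\<close> of the others would have their
  hull in the complementary open half-plane, which misses \<open>\<mu>\<close>.\<close>

lemma depth_of_Omega: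
  assumes U: "U \<in> carrier_mat n n" "char_poly U = (\<Prod>e\<leftarrow>es. [:- e, 1:])"
    and \<mu>: "\<mu> \<in> Omega k U" and k: "k \<le> n"
  shows "depth (\<lambda>j. es ! j - \<mu>) {..<n} k"
  unfolding depth_def
proof (intro allI impI)
  fix w :: complex assume "w \<noteq> 0"
  define H where "H = {l \<in> {..<n}. 0 \<le> Re (cnj w * (es ! l - \<mu>))}"
  have "k \<le> card H"
  proof (rule ccontr)
    assume "\<not> k \<le> card H"
    moreover have "card ({..<n} - H) = n - card H"
      by (subst card_Diff_subset) (auto simp: H_def)
    ultimately have "n - k + 1 \<le> card ({..<n} - H)" using k by simp
    then obtain S where S: "S \<subseteq> {..<n} - H" "card S = n - k + 1"
      by (rule obtain_subset_with_card_n)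
    then have "\<mu> \<in> convex hull ((\<lambda>j. es ! j) ` S)"
      using \<mu> unfolding Omega_eq_listing[OF U] by blast
    moreover have "convex hull ((\<lambda>j. es ! j) ` S) \<subseteq> {x. inner w x < inner w \<mu>}"
      using S(1) by (intro hull_minimal convex_halfspace_lt)
        (auto simp: H_def inner_complex_def algebra_simps)
    ultimately show False by auto
  qed
  then show "k \<le> card {l \<in> {..<n}. 0 \<le> Re (cnj w * (es ! l - \<mu>))}" by (simp add: H_def)
qed

text \<open>With orthonormality, isotropy for the shifted eigenvalues says that the diagonal matrix
  compresses to \<open>\<mu>\<close> times the identity; \<open>Q\<close> carries the vectors to the
  original basis.\<close>

lemma higher_rank_numerical_range_of_isotropic:
  assumes U: "U \<in> carrier_mat n n"
    and Q: "Q \<in> carrier_mat n n" "mat_adjoint Q * Q = 1\<^sub>m n"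
    and es: "length es = n" and diag: "U = Q * diag_of es * mat_adjoint Q"
    and iso: "isotropic (\<lambda>j. es ! j - \<mu>) {..<n} k"
  shows "\<mu> \<in> higher_rank_numerical_range k U"
proof -
  obtain v where v: "\<And>a b. a < k \<Longrightarrow> b < k \<Longrightarrow> (\<Sum>l<n. v a l * v b l) = of_bool (a = b)"
      "\<And>a b. a < k \<Longrightarrow> b < k \<Longrightarrow> (\<Sum>l<n. (v a l * v b l) *\<^sub>R (es ! l - \<mu>)) = 0"
    using iso unfolding isotropic_def by blast
  define V where "V = mat n k (\<lambda>(l, a). complex_of_real (v a l))"
  have V: "V \<in> carrier_mat n k" by (simp add: V_def)
  note Va = mat_adjoint_carrier[OF V]
  note Qa = mat_adjoint_carrier[OF Q(1)]
  have D: "diag_of es \<in> carrier_mat n n" using es by simp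
  have VV: "mat_adjoint V * V = 1\<^sub>m k"
  proof (rule eq_matI)
    fix a b assume "a < dim_row (1\<^sub>m k :: complex mat)" "b < dim_col (1\<^sub>m k :: complex mat)"
    then have ab: "a < k" "b < k" by auto
    have "(mat_adjoint V * V) $$ (a, b) = of_real (\<Sum>l<n. v a l * v b l)"
      using ab by (simp add: index_mult_mat_sum[OF Va V] mat_adjoint_index[OF V] del: index_mult_mat(1))
        (simp add: V_def)
    then show "(mat_adjoint V * V) $$ (a, b) = 1\<^sub>m k $$ (a, b)" using ab by (simp add: v(1))
  qed (use carrier_matD[OF V] in simp_all)
  have DV: "diag_of es * V \<in> carrier_mat n k" using D V by simp
  have VDV: "mat_adjoint V * (diag_of es * V) = \<mu> \<cdot>\<^sub>m 1\<^sub>m k"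
  proof (rule eq_matI)
    fix a b assume "a < dim_row (\<mu> \<cdot>\<^sub>m 1\<^sub>m k)" "b < dim_col (\<mu> \<cdot>\<^sub>m 1\<^sub>m k)"
    then have ab: "a < k" "b < k" by auto
    have "(mat_adjoint V * (diag_of es * V)) $$ (a, b) =
        (\<Sum>l<n. mat_adjoint V $$ (a, l) * (diag_of es * V) $$ (l, b))"
      by (rule index_mult_mat_sum[OF Va DV ab])
    \<comment> \<open>Each eigenvalue is split as \<open>(es ! l - \<mu>) + \<mu>\<close>, which
      leaves the form and the inner product.\<close>
    also have "\<dots> = (\<Sum>l<n. (v a l * v b l) *\<^sub>R (es ! l - \<mu>) + \<mu> * of_real (v a l * v b l))"
      using ab by (intro sum.cong refl)
        (simp add: mult_diag_of_left[OF V es] mat_adjoint_index[OF V],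
          simp add: V_def scaleR_conv_of_real algebra_simps)
    also have "\<dots> = \<mu> * of_real (\<Sum>l<n. v a l * v b l)"
      using ab by (simp only: sum.distrib v(2)) (simp add: sum_distrib_left)
    finally show "(mat_adjoint V * (diag_of es * V)) $$ (a, b) = (\<mu> \<cdot>\<^sub>m 1\<^sub>m k) $$ (a, b)"
      using ab by (simp add: v(1))
  qed (use carrier_matD[OF V] in simp_all)
  define W where "W = Q * V"
  have W: "W \<in> carrier_mat n k" using Q V by (simp add: W_def)
  have Wa: "mat_adjoint W = mat_adjoint V * mat_adjoint Q"
    unfolding W_def by (rule mat_adjoint_mult[OF Q(1) V])
  have QW: "mat_adjoint Q * W = V"
    unfolding W_def using assoc_mult_mat[OF Qa Q(1) V] Q(2) V by simp
  have "mat_adjoint W * W = mat_adjoint V * (mat_adjoint Q * W)"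
    unfolding Wa by (rule assoc_mult_mat[OF Va Qa W])
  then have "mat_adjoint W * W = 1\<^sub>m k" by (simp add: QW VV)
  moreover have "mat_adjoint W * U * W = \<mu> \<cdot>\<^sub>m 1\<^sub>m k"
  proof -
    have "U * W = Q * (diag_of es * V)"
      unfolding diag using Q(1) D Qa W
      by (simp add: assoc_mult_mat[of _ n n _ n _ k] assoc_mult_mat[of _ n n _ n _ n] QW
        mult_carrier_mat[of _ n n _ n] mult_carrier_mat[of _ n n _ k])
    then have "mat_adjoint Q * (U * W) = diag_of es * V"
      using assoc_mult_mat[OF Qa Q(1) DV] Q(2) left_mult_one_mat[OF DV] by simp
    moreover have "mat_adjoint W * U * W = mat_adjoint V * (mat_adjoint Q * (U * W))"
      unfolding Wa using Va Qa U W
      by (simp add: assoc_mult_mat[of _ k n _ n _ k] assoc_mult_mat[of _ k n _ n _ n]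
          assoc_mult_mat[of _ n n _ n _ k]
        mult_carrier_mat[of _ k n _ n] mult_carrier_mat[of _ n n _ k] mult_carrier_mat[of _ n n _ n])
    ultimately show ?thesis by (simp add: VDV)
  qed
  ultimately show ?thesis by (rule higher_rank_numerical_rangeI[OF U W])
qed

text \<open>The half-plane beyond the tangent to the unit circle at a point meets the circle only
  there, so the depth at such a point is at most 1. This supplies the nonzero differences required
  by the cyclic listing.\<close>

lemma depth_imp_ne_center:
  assumes "finite Z" "depth (\<lambda>l. e l - \<mu>) Z k" "2 \<le> k" "inj_on e Z" "\<And>l. l \<in> Z \<Longrightarrow> cmod (e l) = 1"
    and "l \<in> Z"
  shows "e l \<noteq> \<mu>"
proof
  assume \<mu>: "e l = \<mu>"
  have "{m \<in> Z. 0 \<le> Re (cnj \<mu> * (e m - \<mu>))} \<subseteq> {l}"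
  proof clarify
    fix m assume m: "m \<in> Z" "0 \<le> Re (cnj \<mu> * (e m - \<mu>))"
    have "cmod (e m - \<mu>) ^ 2 = cmod (e m) ^ 2 + cmod \<mu> ^ 2 - 2 * Re (cnj \<mu> * e m)"
      unfolding cmod_power2 by (simp add: power2_eq_square algebra_simps)
    moreover have "Re (cnj \<mu> * (e m - \<mu>)) = Re (cnj \<mu> * e m) - cmod \<mu> ^ 2"
      unfolding cmod_power2 by (simp add: power2_eq_square algebra_simps)
    ultimately have "cmod (e m - \<mu>) ^ 2 \<le> 0"
      using m(2) assms(5)[OF m(1)] assms(5)[OF assms(6)] \<mu> by simp
    then have "e m = e l" using \<mu> by simp
    then show "m = l" using assms(4,6) m(1) by (simp add: inj_on_eq_iff)
  qed
  then have "card {m \<in> Z. 0 \<le> Re (cnj \<mu> * (e m - \<mu>))} \<le> card {l}"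
    by (intro card_mono) auto
  moreover have "\<mu> \<noteq> 0" using assms(5)[OF assms(6)] \<mu> by auto
  ultimately show False using assms(2,3) unfolding depth_def by fastforce
qed

theorem corollary6p7:
  fixes k :: nat and U :: "complex mat"
  assumes "k \<ge> 1"
    and "U \<in> carrier_mat (3 * k - 1) (3 * k - 1)"
    and "unitary_mat U"
    and "card (spectrum U) = 3 * k - 1"
  shows "higher_rank_numerical_range k U = Omega k U"
proof -
  define n where "n = 3 * k - 1"
  define es where "es = eigenvalue_list U"
  have U: "U \<in> carrier_mat n n" using assms(2) by (simp add: n_def)
  have kn: "k \<le> n" using assms(1) by (simp add: n_def)
  have cp: "char_poly U = (\<Prod>e\<leftarrow>es. [:- e, 1:])" and len: "length es = n"
    using char_poly_eigenvalue_list[OF U] length_eigenvalue_list[OF U] by (simp_all add: es_def)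
  have ev: "eigenvalue U e \<longleftrightarrow> e \<in> set es" for e
    unfolding eigenvalue_root_char_poly[OF U] cp by (auto simp: poly_prod_list prod_list_zero_iff)
  then have "spectrum U = set es" by (auto simp: spectrum_def)
  then have dist: "distinct es"
    using assms(4) len by (intro card_distinct) (simp add: n_def)
  obtain Q where Q: "Q \<in> carrier_mat n n" "mat_adjoint Q * Q = 1\<^sub>m n" "Q * mat_adjoint Q = 1\<^sub>m n"
    "U = Q * diag_of es * mat_adjoint Q" and unit: "\<And>e. e \<in> set es \<Longrightarrow> cnj e * e = 1"
    using unitary_diagonalization[OF U assms(3) dist len] ev by blast
  show ?thesis
  proof
    show "higher_rank_numerical_range k U \<subseteq> Omega k U"
      by (rule higher_rank_numerical_range_subset_Omega[OF U assms(1) kn Q(1-3) len cp Q(4)])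
    show "Omega k U \<subseteq> higher_rank_numerical_range k U"
    proof
      fix \<mu> assume "\<mu> \<in> Omega k U"
      then have depth: "depth (\<lambda>j. es ! j - \<mu>) {..<n} k"
        by (rule depth_of_Omega[OF U cp _ kn])
      have "isotropic (\<lambda>j. es ! j - \<mu>) {..<n} k"
      \<comment> \<open>For \<open>k = 1\<close> the point \<open>\<mu>\<close> may itself be an
        eigenvalue, so the hull criterion is used, which allows zero differences.\<close>
      proof (cases "k = 1")
        case True
        then show ?thesis using depth isotropic_1_of_depth by blast
      next
        case False
        then have k: "2 \<le> k" using assms(1) by simp
        have "cmod (es ! l) = 1" if "l < n" for l
        proof -
          have "complex_of_real ((cmod (es ! l))\<^sup>2) = 1"
            using unit[of "es ! l"] that len by (simp add: complex_norm_square mult.commute del: of_real_power)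
          then show ?thesis by (simp add: power2_eq_1_iff del: of_real_power) (use norm_ge_zero[of "es ! l"] in linarith)
        qed
        moreover have "inj_on (\<lambda>l. es ! l) {..<n}"
          using dist len by (intro inj_on_nth) auto
        ultimately have "es ! l - \<mu> \<noteq> 0" if "l \<in> {..<n}" for l
          using depth_imp_ne_center[OF _ depth k _ _ that] by auto
        then show ?thesis
          using depth k by (intro isotropic_of_depth) (auto simp: n_def)
      qed
      then show "\<mu> \<in> higher_rank_numerical_range k U"
        by (rule higher_rank_numerical_range_of_isotropic[OF U Q(1,2) len Q(4)])
    qed
  qed
qed

end
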